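(* Let $(x_t)_{t\in[0,T]}$ and $(\tilde x_t)_{t\in[0,T]}$ be PDPs with characteristics $(\Phi,\lambda,Q)$ and $(\Phi,\tilde\lambda,\tilde Q)$ respectively, constructed by thinning from the same data $(N^*_t),(U_k),(V_k)$ and with the same initial point $x\in E$. Assume that $\tilde\lambda$ and $\tilde Q$ depend only on $\theta$, that $\tilde Q$ is always positive, i.e. $\tilde Q(\theta,\theta')>0$ for all $\theta,\theta'\in\Theta$, and that $0<\tilde\lambda(\theta)<\lambda^*$ for all $\theta\in\Theta$. For $t\in[0,T]$ let $\tilde R_t=\tilde R_{\tilde N_t}$ be the weight defined in the context. Then for every bounded measurable $g:E\to\mathbb R$, $$\mathbb E[g(\tilde x_t)\,\tilde R_t]=\mathbb E[g(x_t)].$$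
   Context: Let $\Theta=\{k_1,\dots,k_{|\Theta|}\}$ be a finite or countable set and $E=\Theta\times\mathbb R$; elements of $E$ are written $x=(\theta,\nu)$. A piecewise deterministic process (PDP) is specified by characteristics $(\Phi,\lambda,Q)$: (Borel measurable) functions $\Phi_\theta:\mathbb R_+\times\mathbb R\to\mathbb R$, $\theta\in\Theta$; a measurable function $\lambda:E\to(0,\infty)$; a transition kernel $Q$ on $E$ of the form $Q((\theta,\nu),A\times B)=Q((\theta,\nu),A)\,\delta_\nu(B)$ for $A\subseteq\Theta$, $B\in\mathcal B(\mathbb R)$ (only the $\theta$-component jumps). We write $Q(x,\theta')=Q(x,\{\theta'\})$. Standing assumption: there is a constant $\lambda^*<\infty$ with $\lambda(x)\le\lambda^*$ for all $x\in E$. If $\tilde\lambda,\tilde Q$ depend only on $\theta$ we write $\tilde\lambda(\theta)$ and $\tilde Q(\theta,\theta')$ for $\tilde\lambda(\theta,\nu)$ and $\tilde Q((\theta,\nu),\{\theta'\})$. Data: on a probability space, a homogeneous Poisson process $(N^*_t)_{t\ge0}$ with intensity $\lambda^*$ and jump times $(T^*_k)_{k\ge1}$, $T^*_0=0$; two i.i.d. sequences $(U_k)_{k\ge1}$, $(V_k)_{k\ge1}$ of uniform variables on $[0,1]$, independent of each other and of $(T^*_k)$. Construction by thinning: let $a_0=0$, $a_j(x)=\sum_{i=1}^jQ(x,\{k_i\})$ and $H(x,u)=\sum_i k_i\mathbf 1_{a_{i-1}(x)<u\le a_i(x)}$. Start from $(\theta_0,\nu_0)\in E$, $T_0=0$,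 $\tau_0=0$. For $n\ge1$, $$\tau_n=\inf\{k>\tau_{n-1}:U_k\lambda^*\le\lambda(\theta_{n-1},\Phi_{\theta_{n-1}}(T^*_k-T^*_{\tau_{n-1}},\nu_{n-1}))\},\qquad T_n=T^*_{\tau_n},$$ $$\nu_n=\Phi_{\theta_{n-1}}(T_n-T_{n-1},\nu_{n-1}),\qquad \theta_n=H((\theta_{n-1},\nu_n),V_n)$$ (with $T_n=\infty$ if the set is empty). The PDP is $x_t=(\theta_n,\Phi_{\theta_n}(t-T_n,\nu_n))$ for $t\in[T_n,T_{n+1})$, with $x_0=(\theta_0,\nu_0)$, and $N_t=\sum_{n\ge1}\mathbf 1_{T_n\le t}$. For $(\tilde x_t)$ the corresponding objects are denoted $\tilde\tau_n,\tilde T_n,\tilde\theta_n,\tilde\nu_n,\tilde N_t$ (with its own characteristics in place of $(\Phi,\lambda,Q)$). Weight: put $\kappa_0=1$ and $\kappa_\ell=Q((\tilde\theta_{\ell-1},\tilde\nu_\ell),\tilde\theta_\ell)/\tilde Q(\tilde\theta_{\ell-1},\tilde\theta_\ell)$ for $\ell\ge1$. On $\{\tilde N_t=n\}$, for $0\le\ell\le n-1$, $$\tilde Z_\ell=\kappa_\ell\left(\frac{\tilde\lambda(\tilde\theta_\ell)}{\lambda^*}\Big(1-\frac{\tilde\lambda(\tilde\theta_\ell)}{\lambda^*}\Big)^{\tilde\tau_{\ell+1}-\tilde\tau_\ell-1}\right)^{-1}\frac{\lambda(\tilde\theta_\ell,\Phi_{\tilde\theta_\ell}(T^*_{\tilde\tau_{\ell+1}}-T^*_{\tilde\tau_\ell},\tilde\nu_\ell))}{\lambda^*}\prod_{q=\tilde\tau_\ell+1}^{\tilde\tau_{\ell+1}-1}\left(1-\frac{\lambda(\tilde\theta_\ell,\Phi_{\tilde\theta_\ell}(T^*_q-T^*_{\tilde\tau_\ell},\tilde\nu_\ell))}{\lambda^*}\right),$$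 and for the last index $$\tilde Z_n=\kappa_n\left(\Big(1-\frac{\tilde\lambda(\tilde\theta_n)}{\lambda^*}\Big)^{N^*_t-\tilde\tau_n}\right)^{-1}\prod_{q=\tilde\tau_n+1}^{N^*_t}\left(1-\frac{\lambda(\tilde\theta_n,\Phi_{\tilde\theta_n}(T^*_q-T^*_{\tilde\tau_n},\tilde\nu_n))}{\lambda^*}\right)$$ (empty products equal $1$). Then $\tilde R_t=\tilde R_{\tilde N_t}=\tilde Z_n\prod_{\ell=0}^{n-1}\tilde Z_\ell$ on $\{\tilde N_t=n\}$. *)

theory Defs
  imports "HOL-Probability.Probability"
begin

section \<open>Characteristics of a piecewise deterministic process\<close>

text \<open>
  The mode set \<open>\<Theta>\<close> is the type \<open>'k\<close>, with its numbering \<open>k\<^sub>1, k\<^sub>2, \<dots>\<close> given explicitly because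
  the jump mechanism depends on it; the index set is \<open>{1..m}\<close> if \<open>\<Theta>\<close> is finite and \<open>{1..}\<close> if
  it is infinite.
\<close>

definition enumerates_modes :: "(nat \<Rightarrow> 'k) \<Rightarrow> nat set \<Rightarrow> bool" where
  "enumerates_modes k I \<longleftrightarrow> (I = {1..} \<or> (\<exists>m. I = {1..m})) \<and> bij_betw k I UNIV"

abbreviation pdp_space :: "('k \<times> real) measure" where
  "pdp_space \<equiv> count_space UNIV \<Otimes>\<^sub>M borel"

text \<open>
  The last conjunct is \<open>Q((\<theta>,\<nu>), A \<times> B) = Q((\<theta>,\<nu>), A) \<delta>\<^sub>\<nu>(B)\<close>. Values of \<open>\<Phi>\<close> at negative times
  are irrelevant. Neither \<open>\<Phi> \<theta> 0 \<nu> = \<nu>\<close> nor the semigroup property is imposed.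
\<close>

definition pdp_characteristics ::
  "('k \<Rightarrow> real \<Rightarrow> real \<Rightarrow> real) \<Rightarrow> ('k \<times> real \<Rightarrow> real) \<Rightarrow> ('k \<times> real \<Rightarrow> ('k \<times> real) measure) \<Rightarrow> bool"
where
  "pdp_characteristics \<Phi> lam Q \<longleftrightarrow>
     (\<forall>\<theta>. (\<lambda>(t, \<nu>). \<Phi> \<theta> t \<nu>) \<in> borel_measurable (restrict_space borel ({0..} \<times> UNIV))) \<and>
     lam \<in> borel_measurable pdp_space \<and> (\<forall>x. 0 < lam x) \<and>
     Q \<in> pdp_space \<rightarrow>\<^sub>M prob_algebra pdp_space \<and>
     (\<forall>\<theta> \<nu> A. \<forall>B\<in>sets borel.
        measure (Q (\<theta>, \<nu>)) (A \<times> B) = measure (Q (\<theta>, \<nu>)) (A \<times> UNIV) * indicator B \<nu>)"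

definition mode_prob :: "('k \<times> real \<Rightarrow> ('k \<times> real) measure) \<Rightarrow> 'k \<times> real \<Rightarrow> 'k \<Rightarrow> real" where
  "mode_prob Q x \<theta>' = measure (Q x) ({\<theta>'} \<times> UNIV)"

section \<open>Poisson processes\<close>

text \<open>
  \<open>N\<close> counts the times \<open>T 1 < T 2 < \<dots>\<close> and has independent Poisson increments; \<open>T 0 = 0\<close> is not
  a jump time.
\<close>

definition poisson_process ::
  "'a measure \<Rightarrow> real \<Rightarrow> (real \<Rightarrow> 'a \<Rightarrow> nat) \<Rightarrow> (nat \<Rightarrow> 'a \<Rightarrow> real) \<Rightarrow> bool" where
  "poisson_process M rate N T \<longleftrightarrow>
     (\<forall>\<omega>\<in>space M. T 0 \<omega> = 0 \<and> strict_mono (\<lambda>j. T j \<omega>) \<and>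
        filterlim (\<lambda>j. T j \<omega>) at_top sequentially \<and>
        (\<forall>t\<ge>0. N t \<omega> = card {j. 1 \<le> j \<and> T j \<omega> \<le> t})) \<and>
     (\<forall>j. T j \<in> borel_measurable M) \<and>
     (\<forall>s t. 0 \<le> s \<and> s < t \<longrightarrow>
        distr M (count_space UNIV) (\<lambda>\<omega>. N t \<omega> - N s \<omega>) = measure_pmf (poisson_pmf (rate * (t - s)))) \<and>
     (\<forall>n s. 0 \<le> s 0 \<and> strict_mono s \<longrightarrow>
        prob_space.indep_vars M (\<lambda>_. count_space UNIV)
          (\<lambda>i \<omega>. N (s (Suc i)) \<omega> - N (s i) \<omega>) {..<n::nat})"

definition iid_uniform :: "'a measure \<Rightarrow> (nat \<Rightarrow> 'a \<Rightarrow> real) \<Rightarrow> bool" where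
  "iid_uniform M U \<longleftrightarrow>
     prob_space.indep_vars M (\<lambda>_. borel) U {1..} \<and>
     (\<forall>j\<ge>1. distr M borel (U j) = uniform_measure lborel {0..1})"

text \<open>Mutual independence of the three sequences \<open>(T\<^sub>j)\<close>, \<open>(U\<^sub>j)\<close>, \<open>(V\<^sub>j)\<close>, \<open>j \<ge> 1\<close>, as random
  elements of the sequence space.\<close>

definition indep_sequences ::
  "'a measure \<Rightarrow> (nat \<Rightarrow> 'a \<Rightarrow> real) \<Rightarrow> (nat \<Rightarrow> 'a \<Rightarrow> real) \<Rightarrow> (nat \<Rightarrow> 'a \<Rightarrow> real) \<Rightarrow> bool" where
  "indep_sequences M T U V \<longleftrightarrow>
     prob_space.indep_vars M (\<lambda>_. \<Pi>\<^sub>M j\<in>{1..}. borel)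
       (\<lambda>i \<omega>. \<lambda>j\<in>{1..}. ([T, U, V] ! i) j \<omega>) {..<3}"

section \<open>Construction by thinning\<close>

text \<open>Below, \<open>T\<close>, \<open>U\<close>, \<open>V\<close> are single realisations of the driving sequences.\<close>

definition cum_prob ::
  "(nat \<Rightarrow> 'k) \<Rightarrow> ('k \<times> real \<Rightarrow> ('k \<times> real) measure) \<Rightarrow> 'k \<times> real \<Rightarrow> nat \<Rightarrow> real" where
  "cum_prob k Q x j = (\<Sum>i=1..j. mode_prob Q x (k i))"

text \<open>
  \<open>H(x,u)\<close> is the mode \<open>k\<^sub>i\<close> with \<open>a\<^sub>i\<^sub>-\<^sub>1(x) < u \<le> a\<^sub>i(x)\<close>. There is at most one such \<open>i\<close>, and none
  only on a null set of \<open>u \<in> [0,1]\<close>, where the value is set to \<open>k\<^sub>1\<close>.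
\<close>

definition next_mode ::
  "(nat \<Rightarrow> 'k) \<Rightarrow> nat set \<Rightarrow> ('k \<times> real \<Rightarrow> ('k \<times> real) measure) \<Rightarrow> 'k \<times> real \<Rightarrow> real \<Rightarrow> 'k" where
  "next_mode k I Q x u =
     (if \<exists>i\<in>I. cum_prob k Q x (i - 1) < u \<and> u \<le> cum_prob k Q x i
      then k (THE i. i \<in> I \<and> cum_prob k Q x (i - 1) < u \<and> u \<le> cum_prob k Q x i)
      else k 1)"

text \<open>
  \<open>(\<tau>\<^sub>n, \<theta>\<^sub>n, \<nu>\<^sub>n)\<close>. The infimum of the empty set in \<open>enat\<close> is \<open>\<infinity>\<close>; once \<open>\<tau>\<^sub>n = \<infinity>\<close> it stays so, and
  the other two components, then meaningless, are frozen.
\<close>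

primrec skeleton ::
  "(nat \<Rightarrow> 'k) \<Rightarrow> nat set \<Rightarrow> ('k \<Rightarrow> real \<Rightarrow> real \<Rightarrow> real) \<Rightarrow> ('k \<times> real \<Rightarrow> real) \<Rightarrow>
   ('k \<times> real \<Rightarrow> ('k \<times> real) measure) \<Rightarrow> real \<Rightarrow> 'k \<times> real \<Rightarrow>
   (nat \<Rightarrow> real) \<Rightarrow> (nat \<Rightarrow> real) \<Rightarrow> (nat \<Rightarrow> real) \<Rightarrow> nat \<Rightarrow> enat \<times> 'k \<times> real" where
  "skeleton k I \<Phi> lam Q lam_max x0 T U V 0 = (0, x0)"
| "skeleton k I \<Phi> lam Q lam_max x0 T U V (Suc n) =
    (case skeleton k I \<Phi> lam Q lam_max x0 T U V n of (\<tau>, \<theta>, \<nu>) \<Rightarrow>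
      (case \<tau> of \<infinity> \<Rightarrow> (\<infinity>, \<theta>, \<nu>)
       | enat i \<Rightarrow>
         (case (INF j \<in> {j. i < j \<and> U j * lam_max \<le> lam (\<theta>, \<Phi> \<theta> (T j - T i) \<nu>)}. enat j) of
            \<infinity> \<Rightarrow> (\<infinity>, \<theta>, \<nu>)
          | enat j \<Rightarrow>
              (let \<nu>' = \<Phi> \<theta> (T j - T i) \<nu>
               in (enat j, next_mode k I Q (\<theta>, \<nu>') (V (Suc n)), \<nu>')))))"

definition jump_index :: "(nat \<Rightarrow> enat \<times> 'k \<times> real) \<Rightarrow> nat \<Rightarrow> enat" where
  "jump_index S n = fst (S n)"

definition jump_mode :: "(nat \<Rightarrow> enat \<times> 'k \<times> real) \<Rightarrow> nat \<Rightarrow> 'k" where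
  "jump_mode S n = fst (snd (S n))"

definition jump_pos :: "(nat \<Rightarrow> enat \<times> 'k \<times> real) \<Rightarrow> nat \<Rightarrow> real" where
  "jump_pos S n = snd (snd (S n))"

definition jump_time :: "(nat \<Rightarrow> real) \<Rightarrow> (nat \<Rightarrow> enat \<times> 'k \<times> real) \<Rightarrow> nat \<Rightarrow> ereal" where
  "jump_time T S n = (case jump_index S n of enat j \<Rightarrow> ereal (T j) | \<infinity> \<Rightarrow> \<infinity>)"

definition jump_count :: "(nat \<Rightarrow> real) \<Rightarrow> (nat \<Rightarrow> enat \<times> 'k \<times> real) \<Rightarrow> real \<Rightarrow> nat" where
  "jump_count T S t = card {n. 1 \<le> n \<and> jump_time T S n \<le> ereal t}"

text \<open>The value at \<open>t = 0\<close> is the initial point even if \<open>\<Phi> \<theta> 0\<close> is not the identity.\<close>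

definition pdp_at :: "(nat \<Rightarrow> real) \<Rightarrow> (nat \<Rightarrow> enat \<times> 'k \<times> real) \<Rightarrow>
   ('k \<Rightarrow> real \<Rightarrow> real \<Rightarrow> real) \<Rightarrow> real \<Rightarrow> 'k \<times> real" where
  "pdp_at T S \<Phi> t =
     (if t = 0 then (jump_mode S 0, jump_pos S 0)
      else let n = (THE n. jump_time T S n \<le> ereal t \<and> ereal t < jump_time T S (Suc n))
           in (jump_mode S n,
               \<Phi> (jump_mode S n) (t - real_of_ereal (jump_time T S n)) (jump_pos S n)))"

section \<open>The weight\<close>

text \<open>
  Here \<open>S\<close> is the skeleton of the process with the mode-only rate \<open>lam' \<theta>\<close> and mode-only jump
  probabilities \<open>q' \<theta> \<theta>'\<close>, and \<open>Nt\<close> is the number of points \<open>T j \<le> t\<close>, \<open>j \<ge> 1\<close>. The factors are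
  evaluated only at indices \<open>n\<close> with \<open>jump_index S n < \<infinity>\<close>.
\<close>

definition weight_kappa :: "('k \<times> real \<Rightarrow> ('k \<times> real) measure) \<Rightarrow> ('k \<Rightarrow> 'k \<Rightarrow> real) \<Rightarrow>
   (nat \<Rightarrow> enat \<times> 'k \<times> real) \<Rightarrow> nat \<Rightarrow> real" where
  "weight_kappa Q q' S l =
     (if l = 0 then 1
      else mode_prob Q (jump_mode S (l - 1), jump_pos S l) (jump_mode S l) /
           q' (jump_mode S (l - 1)) (jump_mode S l))"

definition weight_Z ::
  "('k \<Rightarrow> real \<Rightarrow> real \<Rightarrow> real) \<Rightarrow> ('k \<times> real \<Rightarrow> real) \<Rightarrow> ('k \<times> real \<Rightarrow> ('k \<times> real) measure) \<Rightarrow>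
   ('k \<Rightarrow> real) \<Rightarrow> ('k \<Rightarrow> 'k \<Rightarrow> real) \<Rightarrow> real \<Rightarrow> (nat \<Rightarrow> real) \<Rightarrow>
   (nat \<Rightarrow> enat \<times> 'k \<times> real) \<Rightarrow> nat \<Rightarrow> real" where
  "weight_Z \<Phi> lam Q lam' q' lam_max T S l =
     (let \<theta> = jump_mode S l; \<nu> = jump_pos S l;
          i = the_enat (jump_index S l); j = the_enat (jump_index S (Suc l))
      in weight_kappa Q q' S l *
         inverse (lam' \<theta> / lam_max * (1 - lam' \<theta> / lam_max) ^ (j - i - 1)) *
         (lam (\<theta>, \<Phi> \<theta> (T j - T i) \<nu>) / lam_max) *
         (\<Prod>r\<in>{i + 1..<j}. 1 - lam (\<theta>, \<Phi> \<theta> (T r - T i) \<nu>) / lam_max))"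

definition weight_Z_last ::
  "('k \<Rightarrow> real \<Rightarrow> real \<Rightarrow> real) \<Rightarrow> ('k \<times> real \<Rightarrow> real) \<Rightarrow> ('k \<times> real \<Rightarrow> ('k \<times> real) measure) \<Rightarrow>
   ('k \<Rightarrow> real) \<Rightarrow> ('k \<Rightarrow> 'k \<Rightarrow> real) \<Rightarrow> real \<Rightarrow> (nat \<Rightarrow> real) \<Rightarrow>
   (nat \<Rightarrow> enat \<times> 'k \<times> real) \<Rightarrow> nat \<Rightarrow> nat \<Rightarrow> real" where
  "weight_Z_last \<Phi> lam Q lam' q' lam_max T S Nt n =
     (let \<theta> = jump_mode S n; \<nu> = jump_pos S n; i = the_enat (jump_index S n)
      in weight_kappa Q q' S n *
         inverse ((1 - lam' \<theta> / lam_max) ^ (Nt - i)) *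
         (\<Prod>r\<in>{i + 1..Nt}. 1 - lam (\<theta>, \<Phi> \<theta> (T r - T i) \<nu>) / lam_max))"

definition weight_R ::
  "('k \<Rightarrow> real \<Rightarrow> real \<Rightarrow> real) \<Rightarrow> ('k \<times> real \<Rightarrow> real) \<Rightarrow> ('k \<times> real \<Rightarrow> ('k \<times> real) measure) \<Rightarrow>
   ('k \<Rightarrow> real) \<Rightarrow> ('k \<Rightarrow> 'k \<Rightarrow> real) \<Rightarrow> real \<Rightarrow> (nat \<Rightarrow> real) \<Rightarrow>
   (nat \<Rightarrow> enat \<times> 'k \<times> real) \<Rightarrow> nat \<Rightarrow> real \<Rightarrow> real" where
  "weight_R \<Phi> lam Q lam' q' lam_max T S Nt t =
     (let n = jump_count T S t
      in weight_Z_last \<Phi> lam Q lam' q' lam_max T S Nt n *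
         (\<Prod>l<n. weight_Z \<Phi> lam Q lam' q' lam_max T S l))"

end

theory Submission
  imports Defs
begin

text \<open>
  Both processes are functionals of the same Poisson clock.  Conditionally on the clock, thinning is
  a finite recursion over the candidate points up to \<open>t\<close>: candidate \<open>j\<close> is accepted with a
  probability \<open>p\<close> resp. \<open>p'\<close>, and on acceptance the new mode is drawn from \<open>Q\<close> resp. \<open>Q'\<close>.  The weight
  factorises over the candidates into \<open>(Q / Q') (p / p')\<close> for an accepted and
  \<open>(1 - p) / (1 - p')\<close> for a rejected one, so the weighted expectation for \<open>(p', Q')\<close> satisfies the
  same recursion as the expectation for \<open>(p, Q)\<close>.  The distribution of the clock plays no role.
\<close>

section \<open>Uniform marks\<close>

text \<open>The weight is in general unbounded, so the argument runs through nonnegative integrals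
  in \<open>ennreal\<close>: marks are integrated out one at a time, and integrals exchanged with
  sums over countably many modes, before any integrability is known. Signs return only at the end;
  integrability of the weighted side is itself read off from the identity for the absolute value of
  \<open>g\<close>. The definitions describe jumps by infima over all later candidates, the
  recursion decides candidate by candidate. The two are matched for each outcome separately, which
  also supplies measurability of the random variables, defined through \<open>THE\<close> and
  \<open>INF\<close>. The number of candidates up to \<open>t\<close> is random but a function of
  the clock, so it becomes a fixed recursion depth once the clock is frozen.\<close>

abbreviation unif :: "real measure" where
  "unif \<equiv> uniform_measure lborel {0..1}"

abbreviation unif_seq :: "(nat \<Rightarrow> real) measure" where
  "unif_seq \<equiv> \<Pi>\<^sub>M n\<in>UNIV. unif"

lemma prob_space_unif: "prob_space unif"
  by (rule prob_space_uniform_measure) auto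

interpretation unif: prob_space unif
  by (rule prob_space_unif)

interpretation unif_seq: sequence_space unif
  by unfold_locales

lemma sets_unif_seq [measurable_cong]: "sets unif_seq = sets (\<Pi>\<^sub>M n\<in>(UNIV::nat set). (borel :: real measure))"
  by (intro sets_PiM_cong) auto

text \<open>An i.i.d. sequence is its first term followed by an independent copy of the whole.
  Spending one mark thus leaves marks of the same law, which makes a recursion for means
  possible.\<close>

lemma nn_integral_unif_seq_Suc:
  assumes F [measurable]: "F \<in> borel_measurable unif_seq"
  shows "(\<integral>\<^sup>+u. F u \<partial>unif_seq) = (\<integral>\<^sup>+x. \<integral>\<^sup>+u. F (case_nat x u) \<partial>unif_seq \<partial>unif)"
proof -
  have m: "(\<lambda>(s, \<omega>). case_nat s \<omega>) \<in> unif \<Otimes>\<^sub>M unif_seq \<rightarrow>\<^sub>M unif_seq"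
  proof (rule measurable_PiM_single')
    show "(\<lambda>z. (case z of (s, \<omega>) \<Rightarrow> case_nat s \<omega>) n) \<in> unif \<Otimes>\<^sub>M unif_seq \<rightarrow>\<^sub>M unif" for n
      by (cases n) (simp_all add: split_beta')
  qed (auto simp: space_PiM)
  have "(\<integral>\<^sup>+u. F u \<partial>unif_seq) = (\<integral>\<^sup>+z. F (case z of (s, \<omega>) \<Rightarrow> case_nat s \<omega>) \<partial>(unif \<Otimes>\<^sub>M unif_seq))"
    by (subst unif_seq.PiM_iter[symmetric], subst nn_integral_distr[OF m]) (auto simp: unif_seq.PiM_iter)
  also have "\<dots> = (\<integral>\<^sup>+x. \<integral>\<^sup>+u. F (case_nat x u) \<partial>unif_seq \<partial>unif)"
    using measurable_compose[OF m F]
    by (subst unif_seq.P.nn_integral_fst[symmetric]) (auto simp: split_beta')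
  finally show ?thesis .
qed

lemma nn_integral_unif:
  assumes "f \<in> borel_measurable borel"
  shows "(\<integral>\<^sup>+y. f y \<partial>unif) = (\<integral>\<^sup>+y. f y * indicator {0..1} y \<partial>lborel)"
  using assms by (subst nn_integral_uniform_measure) (auto simp: divide_ennreal_def)

text \<open>One acceptance test with success probability \<open>p\<close>; \<open>a\<close> and
  \<open>b\<close> will be the means of what follows acceptance and rejection.\<close>

lemma nn_integral_unif_if_le:
  assumes "0 \<le> p" "p \<le> 1"
  shows "(\<integral>\<^sup>+x. (if x \<le> p then a else b) \<partial>unif) = ennreal p * a + ennreal (1 - p) * b"
proof -
  have "(\<integral>\<^sup>+x. (if x \<le> p then a else b) \<partial>unif)
      = (\<integral>\<^sup>+x. a * indicator {0..p} x + b * indicator {p<..1} x \<partial>lborel)"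
    using assms by (subst nn_integral_unif) (auto intro!: nn_integral_cong simp: indicator_def)
  also have "\<dots> = ennreal p * a + ennreal (1 - p) * b"
    using assms by (subst nn_integral_add) (auto simp: nn_integral_cmult mult.commute)
  finally show ?thesis .
qed

section \<open>Weighted thinning along a fixed clock\<close>

text \<open>One locale serves both processes: weights \<open>1\<close> give the original one,
  likelihood ratios the weighted one. Besides measurability, \<open>nn_integral_sel\<close> is all
  that is kept of the selection map \<open>H\<close>. The payoff \<open>h\<close> depends on the
  mode, the last jump time and the position at that jump. Measurability is asked for each fixed
  mode; countability of the modes takes care of random ones.\<close>

locale weighted_thinning =
  fixes \<Phi> :: "'k \<Rightarrow> real \<Rightarrow> real \<Rightarrow> real"
    and rate :: "'k \<times> real \<Rightarrow> real" and L :: real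
    and sel :: "'k \<times> real \<Rightarrow> real \<Rightarrow> 'k" and q :: "'k \<times> real \<Rightarrow> 'k \<Rightarrow> real"
    and a :: "'k \<Rightarrow> real \<Rightarrow> 'k \<Rightarrow> ennreal" and b :: "'k \<Rightarrow> real \<Rightarrow> ennreal"
    and h :: "'k \<Rightarrow> real \<Rightarrow> real \<Rightarrow> ennreal"
  assumes countable_modes: "countable (UNIV :: 'k set)"
    and measurable_flow: "\<And>\<theta>. (\<lambda>(s, \<nu>). \<Phi> \<theta> s \<nu>) \<in> borel_measurable (borel \<Otimes>\<^sub>M borel)"
    and measurable_rate: "\<And>\<theta>. (\<lambda>\<nu>. rate (\<theta>, \<nu>)) \<in> borel_measurable borel"
    and measurable_sel: "\<And>\<theta>. (\<lambda>(\<nu>, y). sel (\<theta>, \<nu>) y) \<in> borel \<Otimes>\<^sub>M borel \<rightarrow>\<^sub>M count_space UNIV"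
    and measurable_a: "\<And>\<theta> \<theta>'. (\<lambda>\<nu>. a \<theta> \<nu> \<theta>') \<in> borel_measurable borel"
    and measurable_b: "\<And>\<theta>. b \<theta> \<in> borel_measurable borel"
    and measurable_h: "\<And>\<theta>. (\<lambda>(s, \<nu>). h \<theta> s \<nu>) \<in> borel_measurable (borel \<Otimes>\<^sub>M borel)"
    and L_pos: "0 < L"
    and rate_bounds: "\<And>x. 0 \<le> rate x" "\<And>x. rate x \<le> L"
    and nn_integral_sel: "\<And>x f. (\<integral>\<^sup>+y. f (sel x y) \<partial>unif) = (\<integral>\<^sup>+\<theta>'. ennreal (q x \<theta>') * f \<theta>' \<partial>count_space UNIV)"
begin

text \<open>Weighted thinning with \<open>d\<close> candidate points \<open>T (j+1), \<dots>, T (j+d)\<close> still to come, last jump at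
  candidate \<open>i\<close>, and the marks already used dropped from \<open>u\<close> and \<open>v\<close>.  The two sequences are
  shifted at different speeds, since \<open>v\<close> is indexed by jumps and \<open>u\<close> by candidates.\<close>

primrec run :: "(nat \<Rightarrow> real) \<Rightarrow> nat \<Rightarrow> nat \<Rightarrow> nat \<Rightarrow> 'k \<Rightarrow> real \<Rightarrow> (nat \<Rightarrow> real) \<Rightarrow> (nat \<Rightarrow> real) \<Rightarrow> ennreal" where
  "run T 0 j i \<theta> \<nu> u v = h \<theta> (T i) \<nu>"
| "run T (Suc d) j i \<theta> \<nu> u v =
    (let \<nu>' = \<Phi> \<theta> (T (Suc j) - T i) \<nu> in
     if u 0 * L \<le> rate (\<theta>, \<nu>')
     then a \<theta> \<nu>' (sel (\<theta>, \<nu>') (v 0)) *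
       run T d (Suc j) (Suc j) (sel (\<theta>, \<nu>') (v 0)) \<nu>' (\<lambda>n. u (Suc n)) (\<lambda>n. v (Suc n))
     else b \<theta> \<nu>' * run T d (Suc j) i \<theta> \<nu> (\<lambda>n. u (Suc n)) v)"

text \<open>A step replaces the position and shifts the marks, so the induction must allow arbitrary
  measurable functions in these arguments; the discrete arguments stay constant.\<close>

lemma measurable_run:
  assumes T: "\<And>n. (\<lambda>x. Tf x n) \<in> borel_measurable X"
    and "\<nu>f \<in> borel_measurable X"
    and "\<And>n. (\<lambda>x. uf x n) \<in> borel_measurable X" "\<And>n. (\<lambda>x. vf x n) \<in> borel_measurable X"
  shows "(\<lambda>x. run (Tf x) d j i \<theta> (\<nu>f x) (uf x) (vf x)) \<in> borel_measurable X"
  using assms(2-)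
proof (induction d arbitrary: j i \<theta> \<nu>f uf vf)
  note [measurable] = T
  case 0
  note [measurable] = 0
  show ?case
    using measurable_compose[OF _ measurable_h, of "\<lambda>x. (Tf x i, \<nu>f x)" X \<theta>] by simp
next
  note [measurable] = T
  case (Suc d)
  note [measurable] = Suc.prems
  define \<nu>' where "\<nu>' x = \<Phi> \<theta> (Tf x (Suc j) - Tf x i) (\<nu>f x)" for x
  have \<nu>' [measurable]: "\<nu>' \<in> borel_measurable X"
    using measurable_compose[OF _ measurable_flow, of "\<lambda>x. (Tf x (Suc j) - Tf x i, \<nu>f x)" X \<theta>]
    by (simp add: \<nu>'_def[abs_def])
  have [measurable]: "(\<lambda>x. rate (\<theta>, \<nu>' x)) \<in> borel_measurable X"
    by (rule measurable_compose[OF \<nu>' measurable_rate])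
  have [measurable]: "(\<lambda>x. b \<theta> (\<nu>' x)) \<in> borel_measurable X"
    by (rule measurable_compose[OF \<nu>' measurable_b])
  have [measurable]: "(\<lambda>x. a \<theta> (\<nu>' x) \<theta>') \<in> borel_measurable X" for \<theta>'
    by (rule measurable_compose[OF \<nu>' measurable_a])
  have sel: "(\<lambda>x. sel (\<theta>, \<nu>' x) (vf x 0)) \<in> X \<rightarrow>\<^sub>M count_space UNIV"
    using measurable_compose[OF _ measurable_sel, of "\<lambda>x. (\<nu>' x, vf x 0)" X \<theta>] by simp
  have [measurable]: "(\<lambda>x. run (Tf x) d (Suc j) (Suc j) \<theta>' (\<nu>' x) (\<lambda>n. uf x (Suc n)) (\<lambda>n. vf x (Suc n)))
      \<in> borel_measurable X" for \<theta>'
    by (rule Suc.IH) measurable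
  have [measurable]: "(\<lambda>x. run (Tf x) d (Suc j) i \<theta> (\<nu>f x) (\<lambda>n. uf x (Suc n)) (vf x)) \<in> borel_measurable X"
    by (rule Suc.IH) measurable
  \<comment> \<open>The new mode is random here; splitting over its countably many values reduces
    the claim to the fixed \<open>\<theta>'\<close> treated above.\<close>
  have [measurable]: "(\<lambda>x. a \<theta> (\<nu>' x) (sel (\<theta>, \<nu>' x) (vf x 0)) *
      run (Tf x) d (Suc j) (Suc j) (sel (\<theta>, \<nu>' x) (vf x 0)) (\<nu>' x) (\<lambda>n. uf x (Suc n)) (\<lambda>n. vf x (Suc n)))
      \<in> borel_measurable X"
    by (rule measurable_compose_countable'[OF _ sel countable_modes]) measurable
  show ?case
    unfolding run.simps Let_def \<nu>'_def[symmetric] by measurable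
qed

lemma measurable_run_marks [measurable]: "run T d j i \<theta> \<nu> u \<in> borel_measurable unif_seq"
  by (rule measurable_run[where uf = "\<lambda>_. u" and vf = "\<lambda>v. v" and \<nu>f = "\<lambda>_. \<nu>" and Tf = "\<lambda>_. T"]) measurable

text \<open>Since the marks are independent of the clock, this stands in for the conditional
  expectation given the clock.\<close>

definition mean :: "(nat \<Rightarrow> real) \<Rightarrow> nat \<Rightarrow> nat \<Rightarrow> nat \<Rightarrow> 'k \<Rightarrow> real \<Rightarrow> ennreal" where
  "mean T d j i \<theta> \<nu> = (\<integral>\<^sup>+u. \<integral>\<^sup>+v. run T d j i \<theta> \<nu> u v \<partial>unif_seq \<partial>unif_seq)"

lemma mean_0: "mean T 0 j i \<theta> \<nu> = h \<theta> (T i) \<nu>"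
  by (simp add: mean_def unif_seq.emeasure_space_1)

lemma measurable_run_seq [measurable]:
  "(\<lambda>(u, v). run T d j i \<theta> \<nu> u v) \<in> borel_measurable (unif_seq \<Otimes>\<^sub>M unif_seq)"
  unfolding split_beta' by (rule measurable_run) measurable

text \<open>Condition on the first candidate: its mark \<open>u 0\<close> decides the test, and only
  on acceptance is \<open>v 0\<close> spent. What remains is a run with fresh marks, hence again a
  \<open>mean\<close>.\<close>

lemma mean_Suc:
  fixes T j i \<theta> \<nu>
  defines "\<nu>' \<equiv> \<Phi> \<theta> (T (Suc j) - T i) \<nu>"
  shows "mean T (Suc d) j i \<theta> \<nu> =
    ennreal (rate (\<theta>, \<nu>') / L) *
      (\<integral>\<^sup>+\<theta>'. ennreal (q (\<theta>, \<nu>') \<theta>') * (a \<theta> \<nu>' \<theta>' * mean T d (Suc j) (Suc j) \<theta>' \<nu>') \<partial>count_space UNIV) +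
    ennreal (1 - rate (\<theta>, \<nu>') / L) * (b \<theta> \<nu>' * mean T d (Suc j) i \<theta> \<nu>)"
proof -
  let ?p = "rate (\<theta>, \<nu>') / L"
  let ?s = "sel (\<theta>, \<nu>')"
  let ?R = "\<lambda>\<theta>' u v. a \<theta> \<nu>' \<theta>' * run T d (Suc j) (Suc j) \<theta>' \<nu>' u v"
  have sel: "?s \<in> unif \<rightarrow>\<^sub>M count_space UNIV"
    using measurable_compose[OF _ measurable_sel, of "\<lambda>y. (\<nu>', y)" unif \<theta>] by simp
  have jump: "(\<integral>\<^sup>+v. ?R (?s (v 0)) u (\<lambda>n. v (Suc n)) \<partial>unif_seq) =
      (\<integral>\<^sup>+\<theta>'. ennreal (q (\<theta>, \<nu>') \<theta>') * (a \<theta> \<nu>' \<theta>' * (\<integral>\<^sup>+v. run T d (Suc j) (Suc j) \<theta>' \<nu>' u v \<partial>unif_seq)) \<partial>count_space UNIV)"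
    for u
  proof -
    have s0: "(\<lambda>v. ?s (v 0)) \<in> unif_seq \<rightarrow>\<^sub>M count_space UNIV"
      by (rule measurable_compose[OF _ sel]) measurable
    have [measurable]: "(\<lambda>v. run T d j i \<theta> \<nu> u (\<lambda>n. v (Suc n))) \<in> borel_measurable unif_seq" for j i \<theta> \<nu>
      by (rule measurable_run) measurable
    have m: "(\<lambda>v. ?R (?s (v 0)) u (\<lambda>n. v (Suc n))) \<in> borel_measurable unif_seq"
      by (rule measurable_compose_countable'[OF _ s0 countable_modes]) measurable
    have "(\<integral>\<^sup>+v. ?R (?s (v 0)) u (\<lambda>n. v (Suc n)) \<partial>unif_seq) = (\<integral>\<^sup>+y. \<integral>\<^sup>+v. ?R (?s y) u v \<partial>unif_seq \<partial>unif)"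
      by (subst nn_integral_unif_seq_Suc[OF m]) simp
    also have "\<dots> = (\<integral>\<^sup>+y. a \<theta> \<nu>' (?s y) * (\<integral>\<^sup>+v. run T d (Suc j) (Suc j) (?s y) \<nu>' u v \<partial>unif_seq) \<partial>unif)"
      by (intro nn_integral_cong nn_integral_cmult) measurable
    also have "\<dots> = (\<integral>\<^sup>+\<theta>'. ennreal (q (\<theta>, \<nu>') \<theta>') * (a \<theta> \<nu>' \<theta>' * (\<integral>\<^sup>+v. run T d (Suc j) (Suc j) \<theta>' \<nu>' u v \<partial>unif_seq)) \<partial>count_space UNIV)"
      by (rule nn_integral_sel)
    finally show ?thesis .
  qed
  \<comment> \<open>\<open>C\<close> and \<open>D\<close> are the means after acceptance and after
    rejection. Neither depends on the first mark of \<open>u\<close>, so the outermost integral is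
    that of a two-valued function.\<close>
  define C where "C = (\<integral>\<^sup>+\<theta>'. ennreal (q (\<theta>, \<nu>') \<theta>') * (a \<theta> \<nu>' \<theta>' * mean T d (Suc j) (Suc j) \<theta>' \<nu>') \<partial>count_space UNIV)"
  define D where "D = b \<theta> \<nu>' * mean T d (Suc j) i \<theta> \<nu>"
  have C: "(\<integral>\<^sup>+u. \<integral>\<^sup>+v. ?R (?s (v 0)) u (\<lambda>n. v (Suc n)) \<partial>unif_seq \<partial>unif_seq) = C"
  proof -
    interpret sigma_finite_measure "count_space (UNIV :: 'k set)"
      by (rule sigma_finite_measure_count_space_countable) (rule countable_modes)
    interpret psf: pair_sigma_finite unif_seq "count_space (UNIV :: 'k set)" ..
    \<comment> \<open>Tonelli moves the sum over the new modes outside the integral over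
      \<open>u\<close>, so that the inner double integral is again a \<open>mean\<close>.\<close>
    have "(\<lambda>(u, \<theta>'). ennreal (q (\<theta>, \<nu>') \<theta>') * (a \<theta> \<nu>' \<theta>' * (\<integral>\<^sup>+v. run T d (Suc j) (Suc j) \<theta>' \<nu>' u v \<partial>unif_seq)))
        \<in> borel_measurable (unif_seq \<Otimes>\<^sub>M count_space UNIV)"
      unfolding split_beta'
      by (rule measurable_compose_countable'[OF _ measurable_snd countable_modes]) measurable
    from psf.Fubini'[OF this] show ?thesis
      unfolding jump C_def mean_def
      by (simp add: nn_integral_cmult)
  qed
  have D: "(\<integral>\<^sup>+u. \<integral>\<^sup>+v. b \<theta> \<nu>' * run T d (Suc j) i \<theta> \<nu> u v \<partial>unif_seq \<partial>unif_seq) = D"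
    unfolding D_def mean_def
    by (simp add: nn_integral_cmult)
  have "mean T (Suc d) j i \<theta> \<nu> =
      (\<integral>\<^sup>+x. \<integral>\<^sup>+u. \<integral>\<^sup>+v. run T (Suc d) j i \<theta> \<nu> (case_nat x u) v \<partial>unif_seq \<partial>unif_seq \<partial>unif)"
    unfolding mean_def by (rule nn_integral_unif_seq_Suc) measurable
  also have "\<dots> = (\<integral>\<^sup>+x. (if x \<le> ?p then C else D) \<partial>unif)"
    using L_pos by (intro nn_integral_cong) (simp add: Let_def \<nu>'_def[symmetric] C D pos_le_divide_eq)
  also have "\<dots> = ennreal ?p * C + ennreal (1 - ?p) * D"
    using L_pos rate_bounds[of "(\<theta>, \<nu>')"] by (intro nn_integral_unif_if_le) (auto simp: divide_simps)
  finally show ?thesis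
    unfolding C_def D_def .
qed

end

text \<open>In \<open>mean_Suc\<close> the weights turn one set of coefficients into the other:
  \<open>rate' / L * q' * a = rate / L * q\<close>, where positivity of \<open>rate'\<close> and
  \<open>q'\<close> permits the division, and \<open>(1 - rate' / L) * b = 1 - rate / L\<close>,
  where \<open>rate' < L\<close> does. Induction on the number of candidates finishes, the terminal
  value \<open>h\<close> being shared.\<close>

lemma mean_change_of_measure:
  fixes rate rate' :: "'k \<times> real \<Rightarrow> real" and L :: real and q q' :: "'k \<times> real \<Rightarrow> 'k \<Rightarrow> real"
  defines "a \<equiv> \<lambda>\<theta> \<nu> \<theta>'. ennreal (q (\<theta>, \<nu>) \<theta>' / q' (\<theta>, \<nu>) \<theta>' * (rate (\<theta>, \<nu>) / rate' (\<theta>, \<nu>)))"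
    and "b \<equiv> \<lambda>\<theta> \<nu>. ennreal ((1 - rate (\<theta>, \<nu>) / L) / (1 - rate' (\<theta>, \<nu>) / L))"
  assumes P: "weighted_thinning \<Phi> rate L sel q (\<lambda>_ _ _. 1) (\<lambda>_ _. 1) h"
    and P': "weighted_thinning \<Phi> rate' L sel' q' a b h"
    and q: "\<And>x \<theta>. 0 \<le> q x \<theta>" and q': "\<And>x \<theta>. 0 < q' x \<theta>"
    and rate': "\<And>x. 0 < rate' x" "\<And>x. rate' x < L"
  shows "weighted_thinning.mean \<Phi> rate' L sel' a b h T d j i \<theta> \<nu> =
    weighted_thinning.mean \<Phi> rate L sel (\<lambda>_ _ _. 1) (\<lambda>_ _. 1) h T d j i \<theta> \<nu>"
proof -
  interpret P: weighted_thinning \<Phi> rate L sel q "\<lambda>_ _ _. 1" "\<lambda>_ _. 1" h by (rule P)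
  interpret P': weighted_thinning \<Phi> rate' L sel' q' a b h by (rule P')
  have L: "0 < L" by (rule P.L_pos)
  have le: "0 \<le> 1 - rate x / L" "0 < 1 - rate' x / L" for x
    using L P.rate_bounds(2)[of x] rate'[of x] by (auto simp: field_simps)
  show ?thesis
  proof (induction d arbitrary: j i \<theta> \<nu>)
    case 0
    show ?case by (simp add: P.mean_0 P'.mean_0)
  next
    case (Suc d)
    define \<nu>' where "\<nu>' = \<Phi> \<theta> (T (Suc j) - T i) \<nu>"
    let ?x = "(\<theta>, \<nu>')"
    have 1: "ennreal (rate' ?x / L) * (ennreal (q' ?x \<theta>') * (a \<theta> \<nu>' \<theta>' * z)) =
      ennreal (rate ?x / L) * (ennreal (q ?x \<theta>') * (1 * z))" for \<theta>' z
    proof -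
      have "rate' ?x / L * (q' ?x \<theta>' * (q ?x \<theta>' / q' ?x \<theta>' * (rate ?x / rate' ?x))) = rate ?x / L * q ?x \<theta>'"
        using L q'[of ?x \<theta>'] rate'(1)[of ?x] by simp
      then show ?thesis
        using L q'[of ?x \<theta>'] rate'(1)[of ?x] q[of ?x \<theta>'] P.rate_bounds(1)[of ?x]
        by (simp add: a_def mult.assoc[symmetric] ennreal_mult''[symmetric] ennreal_mult'[symmetric] mult.commute[of "q ?x \<theta>'"])
    qed
    have "(1 - rate' ?x / L) * ((1 - rate ?x / L) / (1 - rate' ?x / L)) = 1 - rate ?x / L"
      using le(2)[of ?x] by (metis less_irrefl nonzero_mult_div_cancel_left times_divide_eq_right)
    then have 2: "ennreal (1 - rate' ?x / L) * (b \<theta> \<nu>' * z) = ennreal (1 - rate ?x / L) * (1 * z)" for z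
      using le[of ?x] rate'(2)[of ?x] by (simp add: b_def mult.assoc[symmetric] ennreal_mult'[symmetric] less_imp_le del: times_divide_eq_right)
    show ?case
      unfolding P.mean_Suc P'.mean_Suc \<nu>'_def[symmetric] Suc.IH
      by (simp add: nn_integral_cmult[symmetric] 1 2)
  qed
qed

section \<open>Thinning skeletons\<close>

lemma jump_index_0: "jump_index (skeleton k I \<Phi> lam Q L x0 T U V) 0 = 0"
  by (simp add: jump_index_def zero_enat_def)

lemma skeleton_Suc_infinity:
  assumes "jump_index (skeleton k I \<Phi> lam Q L x0 T U V) n = \<infinity>"
  shows "jump_index (skeleton k I \<Phi> lam Q L x0 T U V) (Suc n) = \<infinity>"
  using assms by (auto simp: jump_index_def split: prod.splits)

lemma skeleton_Suc_enat:
  fixes k I \<Phi> lam Q L x0 T U V n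
  defines "S \<equiv> skeleton k I \<Phi> lam Q L x0 T U V"
  defines "\<nu>' \<equiv> \<lambda>i j. \<Phi> (jump_mode S n) (T j - T i) (jump_pos S n)"
  assumes i: "jump_index S n = enat i"
  shows "jump_index S (Suc n) = (INF j\<in>{j. i < j \<and> U j * L \<le> lam (jump_mode S n, \<nu>' i j)}. enat j)"
    and "jump_index S (Suc n) = enat j \<Longrightarrow> jump_pos S (Suc n) = \<nu>' i j"
    and "jump_index S (Suc n) = enat j \<Longrightarrow>
      jump_mode S (Suc n) = next_mode k I Q (jump_mode S n, \<nu>' i j) (V (Suc n))"
proof -
  obtain \<theta> \<nu> where n: "S n = (enat i, \<theta>, \<nu>)"
    using i unfolding jump_index_def by (metis prod.collapse)
  show "jump_index S (Suc n) = (INF j\<in>{j. i < j \<and> U j * L \<le> lam (jump_mode S n, \<nu>' i j)}. enat j)"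
    and "jump_index S (Suc n) = enat j \<Longrightarrow> jump_pos S (Suc n) = \<nu>' i j"
    and "jump_index S (Suc n) = enat j \<Longrightarrow>
      jump_mode S (Suc n) = next_mode k I Q (jump_mode S n, \<nu>' i j) (V (Suc n))"
    using n unfolding S_def \<nu>'_def
    by (simp_all add: jump_index_def jump_pos_def jump_mode_def Let_def split: enat.splits)
qed

text \<open>The infimum runs over indices beyond \<open>i\<close> and is \<open>\<infinity>\<close>
  if there are none, so the inequality is strict in either case.\<close>

lemma jump_index_Suc_less:
  assumes "jump_index (skeleton k I \<Phi> lam Q L x0 T U V) n = enat i"
  shows "enat i < jump_index (skeleton k I \<Phi> lam Q L x0 T U V) (Suc n)"
proof -
  have "enat (Suc i) \<le> jump_index (skeleton k I \<Phi> lam Q L x0 T U V) (Suc n)"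
    unfolding skeleton_Suc_enat(1)[OF assms] by (intro INF_greatest) auto
  then show ?thesis
    by (rule less_le_trans[rotated]) simp
qed

lemma mono_jump_index: "mono (jump_index (skeleton k I \<Phi> lam Q L x0 T U V))"
proof (rule incseq_SucI)
  fix n
  show "jump_index (skeleton k I \<Phi> lam Q L x0 T U V) n \<le> jump_index (skeleton k I \<Phi> lam Q L x0 T U V) (Suc n)"
  proof (cases "jump_index (skeleton k I \<Phi> lam Q L x0 T U V) n")
    case (enat i)
    then show ?thesis
      using jump_index_Suc_less[OF enat] by (simp only: less_imp_le)
  next
    case infinity
    then show ?thesis
      by (simp only: skeleton_Suc_infinity order_refl)
  qed
qed

text \<open>Translates the infimum into a local decision: once the next jump is known to lie beyond
  \<open>j\<close>, the test at \<open>Suc j\<close> alone decides whether it happens there.\<close>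

lemma jump_index_Suc_eq_iff:
  fixes k I \<Phi> lam Q L x0 T U V n
  defines "S \<equiv> skeleton k I \<Phi> lam Q L x0 T U V"
  assumes i: "jump_index S n = enat i" "i \<le> j" "enat j < jump_index S (Suc n)"
  shows "jump_index S (Suc n) = enat (Suc j) \<longleftrightarrow>
    U (Suc j) * L \<le> lam (jump_mode S n, \<Phi> (jump_mode S n) (T (Suc j) - T i) (jump_pos S n))"
    (is "_ \<longleftrightarrow> ?acc")
proof
  let ?A = "{l. i < l \<and> U l * L \<le> lam (jump_mode S n, \<Phi> (jump_mode S n) (T l - T i) (jump_pos S n))}"
  have INF: "jump_index S (Suc n) = (INF l\<in>?A. enat l)"
    using skeleton_Suc_enat(1) i unfolding S_def by blast
  { assume "jump_index S (Suc n) = enat (Suc j)"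
    \<comment> \<open>A finite infimum cannot come from the empty set, and a nonempty subset of the
      well-ordered \<open>enat\<close> attains its infimum.\<close>
    moreover from this have "enat ` ?A \<noteq> {}"
      unfolding INF by (metis Inf_empty enat.distinct(1) top_enat_def)
    then have "Inf (enat ` ?A) \<in> enat ` ?A"
      using LeastI_ex[of "\<lambda>x. x \<in> enat ` ?A"] by (auto simp: Inf_enat_def)
    ultimately have "enat (Suc j) \<in> enat ` ?A"
      by (simp add: INF)
    then show ?acc
      by auto }
  { assume ?acc
    with i have "jump_index S (Suc n) \<le> enat (Suc j)"
      unfolding INF by (intro INF_lower) auto
    with i(3) show "jump_index S (Suc n) = enat (Suc j)"
      by (cases "jump_index S (Suc n)") auto }
qed

text \<open>By the hypothesis on \<open>m\<close>, comparing jump times with \<open>t\<close>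
  amounts to comparing jump indices with \<open>m\<close>, infinite ones included. Monotonicity of
  \<open>jump_index\<close> then makes \<open>n\<close> both the count and the unique index picked
  by \<open>THE\<close>.\<close>

lemma pdp_at_skeleton:
  fixes k I \<Phi> lam Q L x0 T U V n
  defines "S \<equiv> skeleton k I \<Phi> lam Q L x0 T U V"
  assumes m: "\<And>j. T j \<le> t \<longleftrightarrow> j \<le> m"
    and i: "jump_index S n = enat i" "i \<le> m" "enat m < jump_index S (Suc n)"
  shows "jump_count T S t = n"
    and "pdp_at T S \<Phi> t = (if t = 0 then x0 else (jump_mode S n, \<Phi> (jump_mode S n) (t - T i) (jump_pos S n)))"
proof -
  have le: "jump_time T S l \<le> ereal t \<longleftrightarrow> l \<le> n" for l
  proof -
    have "jump_time T S l \<le> ereal t \<longleftrightarrow> jump_index S l \<le> enat m"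
      by (cases "jump_index S l") (simp_all add: jump_time_def m)
    also have "\<dots> \<longleftrightarrow> l \<le> n"
    proof
      assume "l \<le> n"
      then have "jump_index S l \<le> jump_index S n"
        unfolding S_def by (rule monoD[OF mono_jump_index])
      also have "\<dots> \<le> enat m"
        using i by simp
      finally show "jump_index S l \<le> enat m" .
    next
      assume l: "jump_index S l \<le> enat m"
      show "l \<le> n"
      proof (rule ccontr)
        assume "\<not> l \<le> n"
        then have "jump_index S (Suc n) \<le> jump_index S l"
          unfolding S_def by (intro monoD[OF mono_jump_index]) simp
        with l i(3) show False
          by (meson leD order_trans)
      qed
    qed
    finally show ?thesis .
  qed
  have "{l. 1 \<le> l \<and> jump_time T S l \<le> ereal t} = {1..n}"
    by (auto simp: le)
  then show "jump_count T S t = n"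
    by (simp add: jump_count_def)
  have *: "jump_time T S l \<le> ereal t \<and> ereal t < jump_time T S (Suc l) \<longleftrightarrow> l = n" for l
    using le[of l] le[of "Suc l"] by (auto simp: not_le[symmetric])
  have "(jump_mode S 0, jump_pos S 0) = x0"
    by (simp add: S_def jump_mode_def jump_pos_def)
  then show "pdp_at T S \<Phi> t = (if t = 0 then x0 else (jump_mode S n, \<Phi> (jump_mode S n) (t - T i) (jump_pos S n)))"
    unfolding pdp_at_def * by (simp add: jump_time_def i Let_def)
qed

context weighted_thinning
begin

text \<open>\<open>A n j\<close> is the weight collected up to candidate \<open>j\<close> when \<open>n\<close> jumps have occurred; \<open>A n j\<close>
  times the remaining run is invariant in \<open>j\<close>.\<close>

lemma run_along_skeleton:
  fixes k I \<Psi> Q x0 T U V and A :: "nat \<Rightarrow> nat \<Rightarrow> ennreal"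
  defines "S \<equiv> skeleton k I \<Psi> rate Q L x0 T U V"
  assumes sel: "sel = next_mode k I Q"
    and flow: "\<And>\<theta> s \<nu>. 0 \<le> s \<Longrightarrow> \<Phi> \<theta> s \<nu> = \<Psi> \<theta> s \<nu>"
    and T: "mono T"
    and stay: "\<And>n i j. jump_index S n = enat i \<Longrightarrow> i \<le> j \<Longrightarrow> enat (Suc j) < jump_index S (Suc n) \<Longrightarrow>
      A n (Suc j) = A n j * b (jump_mode S n) (\<Psi> (jump_mode S n) (T (Suc j) - T i) (jump_pos S n))"
    and jump: "\<And>n i j. jump_index S n = enat i \<Longrightarrow> i \<le> j \<Longrightarrow> jump_index S (Suc n) = enat (Suc j) \<Longrightarrow>
      A (Suc n) (Suc j) = A n j * a (jump_mode S n) (jump_pos S (Suc n)) (jump_mode S (Suc n))"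
    and "jump_index S n = enat i" "i \<le> j" "enat j < jump_index S (Suc n)"
  shows "\<exists>n' i'. jump_index S n' = enat i' \<and> i' \<le> j + d \<and> enat (j + d) < jump_index S (Suc n') \<and>
    A n j * run T d j i (jump_mode S n) (jump_pos S n) (\<lambda>l. U (Suc (j + l))) (\<lambda>l. V (Suc (n + l))) =
    A n' (j + d) * h (jump_mode S n') (T i') (jump_pos S n')"
  using assms(7-)
proof (induction d arbitrary: n i j)
  case 0
  then show ?case by (intro exI[of _ n] exI[of _ i]) simp
next
  case (Suc d)
  let ?\<theta> = "jump_mode S n" and ?\<nu> = "jump_pos S n"
  define \<nu>' where "\<nu>' = \<Psi> ?\<theta> (T (Suc j) - T i) ?\<nu>"
  \<comment> \<open>\<open>\<Phi>\<close> and the given flow \<open>\<Psi>\<close> are only known to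
    agree at nonnegative times; monotonicity of the clock makes the elapsed time
    nonnegative.\<close>
  have \<nu>': "\<Phi> ?\<theta> (T (Suc j) - T i) ?\<nu> = \<nu>'"
    unfolding \<nu>'_def using monoD[OF T, of i "Suc j"] Suc.prems(2) by (intro flow) simp
  have acc: "jump_index S (Suc n) = enat (Suc j) \<longleftrightarrow> U (Suc j) * L \<le> rate (?\<theta>, \<nu>')"
    unfolding S_def \<nu>'_def by (rule jump_index_Suc_eq_iff) (use Suc.prems in \<open>auto simp: S_def\<close>)
  show ?case
  proof (cases "jump_index S (Suc n) = enat (Suc j)")
    case True
    note step = skeleton_Suc_enat(2,3)[of k I \<Psi> rate Q L x0 T U V, folded S_def sel, OF Suc.prems(1) True]
    have less: "enat (Suc j) < jump_index S (Suc (Suc n))"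
      using True unfolding S_def by (rule jump_index_Suc_less)
    have "A n j * run T (Suc d) j i ?\<theta> ?\<nu> (\<lambda>l. U (Suc (j + l))) (\<lambda>l. V (Suc (n + l))) =
        A (Suc n) (Suc j) * run T d (Suc j) (Suc j) (jump_mode S (Suc n)) (jump_pos S (Suc n))
          (\<lambda>l. U (Suc (Suc j + l))) (\<lambda>l. V (Suc (Suc n + l)))"
      using True acc jump[OF Suc.prems(1,2) True]
      by (simp add: \<nu>' step \<nu>'_def[symmetric] Let_def mult.assoc)
    with Suc.IH[OF True order_refl less] show ?thesis
      by simp
  next
    case False
    with Suc.prems(3) have less: "enat (Suc j) < jump_index S (Suc n)"
      by (cases "jump_index S (Suc n)") auto
    have "A n j * run T (Suc d) j i ?\<theta> ?\<nu> (\<lambda>l. U (Suc (j + l))) (\<lambda>l. V (Suc (n + l))) =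
        A n (Suc j) * run T d (Suc j) i ?\<theta> ?\<nu> (\<lambda>l. U (Suc (Suc j + l))) (\<lambda>l. V (Suc (n + l)))"
      using False acc stay[OF Suc.prems(1,2) less]
      by (simp add: \<nu>' \<nu>'_def[symmetric] Let_def mult.assoc)
    with Suc.IH[OF Suc.prems(1) _ less] Suc.prems(2) show ?thesis
      by simp
  qed
qed

end

section \<open>Selection of the next mode\<close>

lemma countable_modes_if_enumerates:
  fixes k :: "nat \<Rightarrow> 'k"
  assumes "enumerates_modes k I"
  shows "countable (UNIV :: 'k set)"
  using assms countableI_type[of I] unfolding enumerates_modes_def
  by (metis bij_betw_imp_surj_on countable_image)

lemma measurable_Pair_mode: "(\<lambda>\<nu>. (\<theta>, \<nu>)) \<in> borel \<rightarrow>\<^sub>M pdp_space"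
  by simp

locale mode_kernel =
  fixes k :: "nat \<Rightarrow> 'k" and I :: "nat set" and Q :: "'k \<times> real \<Rightarrow> ('k \<times> real) measure"
  assumes modes: "enumerates_modes k I"
    and kernel: "Q \<in> pdp_space \<rightarrow>\<^sub>M prob_algebra pdp_space"
begin

lemma mode_prob_nonneg: "0 \<le> mode_prob Q x \<theta>"
  by (simp add: mode_prob_def)

lemma measurable_mode_prob: "(\<lambda>x. mode_prob Q x \<theta>) \<in> borel_measurable pdp_space"
  unfolding mode_prob_def
  by (rule measurable_compose[OF kernel measurable_measure_prob_algebra]) (auto intro: pair_measureI)

lemma mono_cum_prob: "mono (cum_prob k Q x)"
  unfolding cum_prob_def by (intro monoI sum_mono2) (auto simp: mode_prob_nonneg)

text \<open>The strips \<open>{k i} \<times> UNIV\<close> with \<open>i \<in> I\<close> partition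
  the space, which has mass 1 under \<open>Q x\<close>. The index is shifted because
  \<open>I\<close> starts at 1, and padding with 0 treats finite and infinite mode sets at
  once.\<close>

lemma mode_prob_sums: "(\<lambda>i. if Suc i \<in> I then mode_prob Q x (k (Suc i)) else 0) sums 1"
proof -
  have x: "x \<in> space pdp_space"
    by (simp add: space_pair_measure)
  interpret Qx: prob_space "Q x"
    using measurable_space[OF kernel x] by (simp add: space_prob_algebra)
  have sets: "sets (Q x) = sets pdp_space"
    using measurable_space[OF kernel x] by (simp add: space_prob_algebra)
  define A where "A i = (if Suc i \<in> I then {k (Suc i)} \<times> (UNIV :: real set) else {})" for i
  have inj: "inj_on k I" and img: "k ` I = UNIV" and I: "\<And>i. i \<in> I \<Longrightarrow> 1 \<le> i"
    using modes by (auto simp: enumerates_modes_def bij_betw_def)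
  have "disjoint_family A"
    using inj by (auto simp: disjoint_family_on_def A_def inj_on_def)
  moreover have "range A \<subseteq> sets (Q x)"
    by (auto simp: A_def sets intro: pair_measureI)
  ultimately have "(\<lambda>i. measure (Q x) (A i)) sums measure (Q x) (\<Union>i. A i)"
    by (intro Qx.finite_measure_UNION)
  moreover have "(\<Union>i. A i) = space (Q x)"
  proof -
    have "\<exists>i. (\<theta>, \<nu>) \<in> A i" for \<theta> \<nu>
    proof -
      obtain i where "i \<in> I" "k i = \<theta>"
        using img by (metis UNIV_I imageE)
      with I[of i] show ?thesis
        by (intro exI[of _ "i - 1"]) (auto simp: A_def)
    qed
    then show ?thesis
      using sets_eq_imp_space_eq[OF sets] by (auto simp: space_pair_measure)
  qed
  ultimately show ?thesis
    by (simp add: A_def mode_prob_def if_distrib[of "measure (Q x)"] Qx.prob_space cong: if_cong)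
qed

text \<open>\<open>I\<close> is an initial segment of the positive integers, so no padding occurs
  before an index in \<open>I\<close>.\<close>

lemma sum_mode_prob:
  assumes "i \<in> I"
  shows "(\<Sum>l<i. if Suc l \<in> I then mode_prob Q x (k (Suc l)) else 0) = cum_prob k Q x i"
proof -
  have "Suc l \<in> I" if "l < i" for l
    using modes assms that by (auto simp: enumerates_modes_def)
  then show ?thesis
    by (simp add: cum_prob_def sum.atLeast1_atMost_eq)
qed

lemma cum_prob_le_1: "i \<in> I \<Longrightarrow> cum_prob k Q x i \<le> 1"
  unfolding sum_mode_prob[symmetric]
  using sum_le_suminf[OF sums_summable[OF mode_prob_sums], of "{..<i}" x]
  by (simp add: sums_unique[OF mode_prob_sums, symmetric] mode_prob_nonneg)

text \<open>Consecutive half-open intervals between values of a monotone sequence are disjoint.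
  Truncated subtraction does no harm: for index 0 the interval is empty.\<close>

lemma cum_prob_interval_unique:
  assumes "cum_prob k Q x (i - 1) < u" "u \<le> cum_prob k Q x i"
    and "cum_prob k Q x (j - 1) < u" "u \<le> cum_prob k Q x j"
  shows "i = j"
proof -
  have "\<not> j \<le> i - 1" "\<not> i \<le> j - 1"
    using assms monoD[OF mono_cum_prob, of j "i - 1" x] monoD[OF mono_cum_prob, of i "j - 1" x] by linarith+
  then show ?thesis
    by linarith
qed

lemma next_mode_eq:
  assumes "i \<in> I" "cum_prob k Q x (i - 1) < u" "u \<le> cum_prob k Q x i"
  shows "next_mode k I Q x u = k i"
proof -
  have "(THE i. i \<in> I \<and> cum_prob k Q x (i - 1) < u \<and> u \<le> cum_prob k Q x i) = i"
    using assms cum_prob_interval_unique by (intro the_equality) blast+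
  with assms show ?thesis
    by (auto simp: next_mode_def)
qed

text \<open>Take the first partial sum that reaches \<open>u\<close>. It exists because the sums
  tend to 1 and \<open>u < 1\<close>; with infinitely many modes the value 1 itself may never be
  reached.\<close>

lemma cum_prob_interval_exists:
  assumes "0 < u" "u < 1"
  shows "\<exists>i\<in>I. cum_prob k Q x (i - 1) < u \<and> u \<le> cum_prob k Q x i"
proof -
  define f where "f i = (if Suc i \<in> I then mode_prob Q x (k (Suc i)) else 0)" for i
  have "\<exists>n. u \<le> sum f {..<n}"
    using order_tendstoD(1)[OF mode_prob_sums[unfolded sums_def] assms(2), of x]
    by (auto simp: f_def eventually_sequentially intro: less_imp_le)
  then obtain n where n: "u \<le> sum f {..<n}" "\<And>l. l < n \<Longrightarrow> \<not> u \<le> sum f {..<l}"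
    using exists_least_iff[of "\<lambda>n. u \<le> sum f {..<n}"] by blast
  with assms(1) obtain l where l: "n = Suc l"
    by (cases n) auto
  \<comment> \<open>Were \<open>n\<close> outside \<open>I\<close>, the last term would be padding
    and the sum of the first \<open>l\<close> terms would already reach \<open>u\<close>.\<close>
  with n(1) n(2)[of l] have I: "n \<in> I"
    by (auto simp: f_def split: if_splits)
  have "sum f {..<l} = cum_prob k Q x l"
    using modes I sum_mode_prob[of l x] unfolding l f_def
    by (cases "l = 0") (auto simp: enumerates_modes_def cum_prob_def)
  moreover have "sum f {..<n} = cum_prob k Q x n"
    unfolding f_def by (rule sum_mode_prob[OF I])
  ultimately show ?thesis
    using n(1) n(2)[of l] I l by (intro bexI[of _ n]) auto
qed

text \<open>The index is unique, so \<open>THE\<close> may be replaced by \<open>LEAST\<close>,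
  which preserves measurability for a sequence of measurable predicates.\<close>

lemma measurable_next_mode:
  "(\<lambda>(\<nu>, y). next_mode k I Q (\<theta>, \<nu>) y) \<in> borel \<Otimes>\<^sub>M borel \<rightarrow>\<^sub>M count_space UNIV"
proof -
  define P where "P \<nu> y i \<longleftrightarrow> i \<in> I \<and> cum_prob k Q (\<theta>, \<nu>) (i - 1) < y \<and> y \<le> cum_prob k Q (\<theta>, \<nu>) i" for \<nu> y i
  have eq: "next_mode k I Q (\<theta>, \<nu>) y = (if \<exists>i. P \<nu> y i then k (LEAST i. P \<nu> y i) else k 1)" for \<nu> y
  proof (cases "\<exists>i. P \<nu> y i")
    case True
    then have "P \<nu> y (LEAST i. P \<nu> y i)"
      by (rule LeastI_ex)
    then have "next_mode k I Q (\<theta>, \<nu>) y = k (LEAST i. P \<nu> y i)"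
      unfolding P_def by (blast intro: next_mode_eq)
    with True show ?thesis
      by simp
  qed (auto simp: P_def next_mode_def)
  have [measurable]: "(\<lambda>\<nu>. cum_prob k Q (\<theta>, \<nu>) i) \<in> borel_measurable borel" for i
    unfolding cum_prob_def
    by (intro borel_measurable_sum measurable_compose[OF measurable_Pair_mode measurable_mode_prob])
  have [measurable]: "Measurable.pred (borel \<Otimes>\<^sub>M borel) (\<lambda>z. P (fst z) (snd z) i)" for i
    unfolding P_def by measurable
  have [measurable]: "k \<in> count_space UNIV \<rightarrow>\<^sub>M count_space UNIV"
    by simp
  show ?thesis
    unfolding eq split_beta' by measurable
qed

text \<open>Inverse transform sampling: up to null sets the preimage of \<open>k i\<close> is an
  interval of length \<open>mode_prob Q x (k i)\<close>. On countably many modes, the masses of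
  singletons determine the law.\<close>

lemma nn_integral_next_mode:
  "(\<integral>\<^sup>+y. f (next_mode k I Q x y) \<partial>unif) = (\<integral>\<^sup>+\<theta>. ennreal (mode_prob Q x \<theta>) * f \<theta> \<partial>count_space UNIV)"
proof -
  have "(\<lambda>y. (snd x, y)) \<in> borel \<rightarrow>\<^sub>M borel \<Otimes>\<^sub>M borel"
    by measurable
  from measurable_compose[OF this measurable_next_mode[of "fst x"]]
  have meas: "next_mode k I Q x \<in> borel \<rightarrow>\<^sub>M count_space UNIV"
    by simp
  then have meas': "next_mode k I Q x \<in> unif \<rightarrow>\<^sub>M count_space UNIV"
    by (subst measurable_cong_sets[of unif borel, OF _ refl]) simp_all
  have img: "k ` I = UNIV"
    using modes by (auto simp: enumerates_modes_def bij_betw_def)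
  have "distr unif (count_space UNIV) (next_mode k I Q x) =
      density (count_space UNIV) (\<lambda>\<theta>. ennreal (mode_prob Q x \<theta>))"
  proof (rule measure_eqI_countable[where A = UNIV])
    fix \<theta> :: 'k
    obtain i where i: "i \<in> I" "\<theta> = k i"
      using img by (metis UNIV_I imageE)
    then have "1 \<le> i"
      using modes by (auto simp: enumerates_modes_def)
    then have cum: "cum_prob k Q x i = cum_prob k Q x (i - 1) + mode_prob Q x \<theta>"
      using i by (cases i) (simp_all add: cum_prob_def)
    have inj: "inj_on k I"
      using modes by (auto simp: enumerates_modes_def bij_betw_def)
    have bounds: "0 \<le> cum_prob k Q x (i - 1)" "cum_prob k Q x i \<le> 1"
      using cum_prob_le_1[OF i(1)] by (auto simp: cum_prob_def intro: sum_nonneg mode_prob_nonneg)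
    \<comment> \<open>At \<open>y = 0\<close>, and possibly at \<open>y = 1\<close>, no interval
      contains \<open>y\<close> and the default \<open>k 1\<close> is returned; these two points are
      discarded as null.\<close>
    have iff: "next_mode k I Q x y = \<theta> \<longleftrightarrow> y \<in> {cum_prob k Q x (i - 1)<..cum_prob k Q x i}"
      if "0 < y" "y < 1" for y
      using cum_prob_interval_exists[OF that, of x] next_mode_eq[of _ x y] i inj
      by (auto simp: inj_on_eq_iff)
    have meas_ind: "(\<lambda>y. indicator {\<theta>} (next_mode k I Q x y) :: ennreal) \<in> borel_measurable borel"
      by (rule measurable_compose[OF meas]) simp
    have "emeasure (distr unif (count_space UNIV) (next_mode k I Q x)) {\<theta>} =
        (\<integral>\<^sup>+\<theta>'. indicator {\<theta>} \<theta>' \<partial>distr unif (count_space UNIV) (next_mode k I Q x))"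
      by (rule nn_integral_indicator[symmetric]) simp
    also have "\<dots> = (\<integral>\<^sup>+y. indicator {\<theta>} (next_mode k I Q x y) \<partial>unif)"
      by (rule nn_integral_distr[OF meas']) simp
    also have "\<dots> = (\<integral>\<^sup>+y. indicator {\<theta>} (next_mode k I Q x y) * indicator {0..1} y \<partial>lborel)"
      by (rule nn_integral_unif[OF meas_ind])
    also have "\<dots> = (\<integral>\<^sup>+y. indicator {cum_prob k Q x (i - 1)<..cum_prob k Q x i} y \<partial>lborel)"
    proof (rule nn_integral_cong_AE)
      show "AE y in lborel. indicator {\<theta>} (next_mode k I Q x y) * indicator {0..1} y =
          (indicator {cum_prob k Q x (i - 1)<..cum_prob k Q x i} y :: ennreal)"
        using AE_lborel_singleton[of 0] AE_lborel_singleton[of 1]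
      proof eventually_elim
        case (elim y)
        then show ?case
          using iff[of y] bounds by (cases "0 < y \<and> y < 1") (auto simp: indicator_def)
      qed
    qed
    also have "\<dots> = ennreal (mode_prob Q x \<theta>)"
      using mode_prob_nonneg[of x \<theta>] by (simp add: cum)
    finally show "emeasure (distr unif (count_space UNIV) (next_mode k I Q x)) {\<theta>} =
        emeasure (density (count_space UNIV) (\<lambda>\<theta>. ennreal (mode_prob Q x \<theta>))) {\<theta>}"
      by (simp add: emeasure_density nn_integral_indicator_singleton')
  qed (use countable_modes_if_enumerates[OF modes] in auto)
  then have "(\<integral>\<^sup>+\<theta>. f \<theta> \<partial>distr unif (count_space UNIV) (next_mode k I Q x)) =
      (\<integral>\<^sup>+\<theta>. f \<theta> \<partial>density (count_space UNIV) (\<lambda>\<theta>. ennreal (mode_prob Q x \<theta>)))"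
    by simp
  then show ?thesis
    using meas' by (simp add: nn_integral_distr nn_integral_density)
qed

end

section \<open>Independence of the driving sequences\<close>

abbreviation borel_seq :: "(nat \<Rightarrow> real) measure" where
  "borel_seq \<equiv> \<Pi>\<^sub>M n\<in>UNIV. borel"

text \<open>Independence makes the law on \<open>{1..}\<close> a product of uniform laws; reindexing
  along the injection \<open>Suc\<close> moves it to all naturals.\<close>

lemma (in prob_space) distr_iid_uniform:
  assumes "iid_uniform M U"
  shows "distr M borel_seq (\<lambda>\<omega> n. U (Suc n) \<omega>) = unif_seq"
proof -
  have ind: "indep_vars (\<lambda>_. borel) U {1..}" and unif: "\<And>j. 1 \<le> j \<Longrightarrow> distr M borel (U j) = unif"
    using assms by (auto simp: iid_uniform_def)
  have rv [measurable]: "random_variable borel (U j)" if "1 \<le> j" for j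
    using ind that by (auto simp: indep_vars_def)
  have "distr M (\<Pi>\<^sub>M i\<in>{1..}. borel) (\<lambda>\<omega>. \<lambda>i\<in>{1..}. U i \<omega>) = (\<Pi>\<^sub>M i\<in>{1..}. distr M borel (U i))"
    using ind rv by (subst (asm) indep_vars_iff_distr_eq_PiM') auto
  also have "\<dots> = (\<Pi>\<^sub>M i\<in>{1..}. unif)"
    by (intro PiM_cong) (auto simp: unif)
  finally have law: "distr M (\<Pi>\<^sub>M i\<in>{1..}. borel) (\<lambda>\<omega>. \<lambda>i\<in>{1..}. U i \<omega>) = (\<Pi>\<^sub>M i\<in>{1..}. unif)" .
  have "unif_seq = distr (\<Pi>\<^sub>M i\<in>{1..}. unif) unif_seq (\<lambda>w n. w (Suc n))"
    using distr_PiM_reindex[of "{1..}" "\<lambda>_. unif" Suc UNIV] prob_space_unif by (simp add: restrict_def)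
  also have "\<dots> = distr (\<Pi>\<^sub>M i\<in>{1..}. unif) borel_seq (\<lambda>w n. w (Suc n))"
    by (intro distr_cong) (auto simp: sets_unif_seq)
  also have "\<dots> = distr M borel_seq (\<lambda>\<omega> n. U (Suc n) \<omega>)"
    unfolding law[symmetric]
    by (subst distr_distr)
      (auto intro!: measurable_PiM_single' measurable_restrict rv distr_cong simp: space_PiM)
  finally show ?thesis ..
qed

text \<open>Independence turns the joint law of the shifted sequences into a product. The laws of
  the marks are replaced by \<open>unif_seq\<close>, while that of the clock is pulled back to
  \<open>M\<close> and never has to be identified.\<close>

lemma (in prob_space) nn_integral_driving_sequences:
  assumes U: "iid_uniform M U" and V: "iid_uniform M V" and ind: "indep_sequences M T U V"
    and F: "(\<lambda>(w, u, v). F w u v) \<in> borel_measurable (borel_seq \<Otimes>\<^sub>M borel_seq \<Otimes>\<^sub>M borel_seq)"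
  shows "(\<integral>\<^sup>+\<omega>. F (\<lambda>n. T (Suc n) \<omega>) (\<lambda>n. U (Suc n) \<omega>) (\<lambda>n. V (Suc n) \<omega>) \<partial>M) =
    (\<integral>\<^sup>+\<omega>. \<integral>\<^sup>+u. \<integral>\<^sup>+v. F (\<lambda>n. T (Suc n) \<omega>) u v \<partial>unif_seq \<partial>unif_seq \<partial>M)"
proof -
  \<comment> \<open>Indices from 3 on repeat \<open>V\<close>, because the product locale wants a
    probability measure at every index.\<close>
  define W where "W i \<omega> n = (if i = 0 then T else if i = 1 then U else V) (Suc n) \<omega>" for i n :: nat and \<omega>
  have "indep_vars (\<lambda>_. borel_seq) (\<lambda>i \<omega>. (\<lambda>w n. w (Suc n)) (\<lambda>j\<in>{1..}. ([T, U, V] ! i) j \<omega>)) {..<3}"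
    by (rule indep_vars_compose2[OF ind[unfolded indep_sequences_def]])
      (auto intro!: measurable_PiM_single' simp: space_PiM)
  also have "?this \<longleftrightarrow> indep_vars (\<lambda>_. borel_seq) W {..<3}"
    by (intro indep_vars_cong) (auto simp: W_def fun_eq_iff less_Suc_eq numeral_3_eq_3)
  finally have W: "indep_vars (\<lambda>_. borel_seq) W {..<3}" .
  have rv [measurable]: "random_variable borel_seq (W i)" for i
  proof -
    have "random_variable borel_seq (W j)" if "j < 3" for j
      using W that by (auto simp: indep_vars_def)
    moreover have "W i = W (min i 2)"
      by (auto simp: W_def fun_eq_iff min_def)
    ultimately show ?thesis
      by simp
  qed
  interpret W: prob_space "distr M borel_seq (W i)" for i
    by (rule prob_space_distr) (rule rv)
  interpret D: product_prob_space "\<lambda>i. distr M borel_seq (W i)" "{..<3}"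
    by unfold_locales
  have three: "{..<3} = {0, 1, 2::nat}"
    by auto
  have law: "distr M (\<Pi>\<^sub>M i\<in>{..<3}. borel_seq) (\<lambda>\<omega>. \<lambda>i\<in>{..<3}. W i \<omega>) = (\<Pi>\<^sub>M i\<in>{..<3}. distr M borel_seq (W i))"
    using W rv by (subst (asm) indep_vars_iff_distr_eq_PiM') (auto simp: three)
  have [measurable (raw)]: "(\<lambda>x. F (f x) (g x) (h x)) \<in> borel_measurable X"
    if "f \<in> X \<rightarrow>\<^sub>M borel_seq" "g \<in> X \<rightarrow>\<^sub>M borel_seq" "h \<in> X \<rightarrow>\<^sub>M borel_seq" for f g h and X :: "'x measure"
    using measurable_compose[OF _ F, of "\<lambda>x. (f x, g x, h x)" X] that by simp
  have law_U: "distr M borel_seq (W 1) = unif_seq" and law_V: "distr M borel_seq (W 2) = unif_seq"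
    using distr_iid_uniform[OF U] distr_iid_uniform[OF V] by (simp_all add: W_def[abs_def])
  have "(\<integral>\<^sup>+\<omega>. F (W 0 \<omega>) (W 1 \<omega>) (W 2 \<omega>) \<partial>M) =
      (\<integral>\<^sup>+x. F (x 0) (x 1) (x 2) \<partial>(\<Pi>\<^sub>M i\<in>{..<3}. distr M borel_seq (W i)))"
    unfolding law[symmetric] by (subst nn_integral_distr) (auto simp: three)
  \<comment> \<open>Tonelli, peeling off the coordinates 0, 1, 2 in turn, so that the clock is the
    outermost variable.\<close>
  also have "\<dots> = (\<integral>\<^sup>+w. \<integral>\<^sup>+u. \<integral>\<^sup>+v. F w u v
      \<partial>distr M borel_seq (W 2) \<partial>distr M borel_seq (W 1) \<partial>distr M borel_seq (W 0))"
    unfolding three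
  proof (subst D.product_nn_integral_insert_rev)
    show "(\<lambda>x. F (x 0) (x 1) (x 2)) \<in> borel_measurable (Pi\<^sub>M {0, 1, 2} (\<lambda>i. distr M borel_seq (W i)))"
      by measurable
    have "(\<integral>\<^sup>+x. F w (x 1) (x 2) \<partial>Pi\<^sub>M {1, 2} (\<lambda>i. distr M borel_seq (W i))) =
        (\<integral>\<^sup>+u. \<integral>\<^sup>+v. F w u v \<partial>distr M borel_seq (W 2) \<partial>distr M borel_seq (W 1))" if w: "w \<in> space borel_seq" for w
    proof (subst D.product_nn_integral_insert_rev)
      note [measurable] = measurable_const[OF w]
      show "(\<lambda>x. F w (x 1) (x 2)) \<in> borel_measurable (Pi\<^sub>M {1, 2} (\<lambda>i. distr M borel_seq (W i)))"
        by measurable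
      show "(\<integral>\<^sup>+u. \<integral>\<^sup>+x. F w ((x(1 := u)) 1) ((x(1 := u)) 2) \<partial>Pi\<^sub>M {2} (\<lambda>i. distr M borel_seq (W i)) \<partial>distr M borel_seq (W 1)) =
        (\<integral>\<^sup>+u. \<integral>\<^sup>+v. F w u v \<partial>distr M borel_seq (W 2) \<partial>distr M borel_seq (W 1))"
      proof (rule nn_integral_cong)
        fix u assume "u \<in> space (distr M borel_seq (W 1))"
        then have u: "u \<in> space borel_seq" by simp
        note [measurable] = measurable_const[OF w] measurable_const[OF u]
        have "(\<lambda>v. F w u v) \<in> borel_measurable (distr M borel_seq (W 2))"
          by measurable
        then show "(\<integral>\<^sup>+x. F w ((x(1 := u)) 1) ((x(1 := u)) 2) \<partial>Pi\<^sub>M {2} (\<lambda>i. distr M borel_seq (W i))) =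
            (\<integral>\<^sup>+v. F w u v \<partial>distr M borel_seq (W 2))"
          using D.product_nn_integral_singleton[of "\<lambda>v. F w u v" 2] by simp
      qed
    qed auto
    then show "(\<integral>\<^sup>+w. \<integral>\<^sup>+x. F ((x(0 := w)) 0) ((x(0 := w)) 1) ((x(0 := w)) 2)
          \<partial>Pi\<^sub>M {1, 2} (\<lambda>i. distr M borel_seq (W i)) \<partial>distr M borel_seq (W 0)) =
        (\<integral>\<^sup>+w. \<integral>\<^sup>+u. \<integral>\<^sup>+v. F w u v
          \<partial>distr M borel_seq (W 2) \<partial>distr M borel_seq (W 1) \<partial>distr M borel_seq (W 0))"
      by (intro nn_integral_cong) simp
  qed auto
  also have "\<dots> = (\<integral>\<^sup>+\<omega>. \<integral>\<^sup>+u. \<integral>\<^sup>+v. F (W 0 \<omega>) u v \<partial>unif_seq \<partial>unif_seq \<partial>M)"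
    unfolding law_U law_V by (subst nn_integral_distr) measurable
  finally show ?thesis
    by (simp add: W_def[abs_def])
qed

section \<open>The Poisson clock: counting candidates and integrating out the marks\<close>

lemma poisson_processD:
  assumes "poisson_process M rate N T"
  shows "T j \<in> borel_measurable M"
    and "\<omega> \<in> space M \<Longrightarrow> T 0 \<omega> = 0"
    and "\<omega> \<in> space M \<Longrightarrow> strict_mono (\<lambda>j. T j \<omega>)"
    and "\<omega> \<in> space M \<Longrightarrow> filterlim (\<lambda>j. T j \<omega>) at_top sequentially"
    and "\<omega> \<in> space M \<Longrightarrow> 0 \<le> t \<Longrightarrow> N t \<omega> = card {j. 1 \<le> j \<and> T j \<omega> \<le> t}"
  using assms unfolding poisson_process_def by blast+

lemma pdp_characteristicsD:
  assumes "pdp_characteristics \<Phi> lam Q"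
  shows "(\<lambda>(t, \<nu>). \<Phi> \<theta> t \<nu>) \<in> borel_measurable (restrict_space borel ({0..} \<times> UNIV))"
    and "lam \<in> borel_measurable pdp_space"
    and "0 < lam x"
    and "Q \<in> pdp_space \<rightarrow>\<^sub>M prob_algebra pdp_space"
  using assms unfolding pdp_characteristics_def by blast+

text \<open>The times increase to infinity, so the candidates up to \<open>t\<close> form an initial
  segment. The first form exhibits \<open>N t\<close> as a function of the clock alone, the second
  is the hypothesis of \<open>pdp_at_skeleton\<close>.\<close>

lemma poisson_process_count:
  assumes N: "poisson_process M rate N T" and \<omega>: "\<omega> \<in> space M" and t: "0 \<le> t"
  shows "N t \<omega> = (LEAST n. t < T (Suc n) \<omega>)"
    and "T j \<omega> \<le> t \<longleftrightarrow> j \<le> N t \<omega>"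
proof -
  note T0 = poisson_processD(2)[OF N \<omega>] and mono = poisson_processD(3)[OF N \<omega>]
    and top = poisson_processD(4)[OF N \<omega>] and count = poisson_processD(5)[OF N \<omega> t]
  have "\<exists>n. t < T n \<omega>"
    using top unfolding filterlim_at_top_dense eventually_sequentially by blast
  then have "\<exists>n. t < T (Suc n) \<omega>"
    using T0 t by (metis not0_implies_Suc not_less)
  then obtain m where m: "m = (LEAST n. t < T (Suc n) \<omega>)" "t < T (Suc m) \<omega>"
    by (metis LeastI_ex)
  have le: "T j \<omega> \<le> t \<longleftrightarrow> j \<le> m" for j
  proof
    assume "T j \<omega> \<le> t"
    with m(2) have "T j \<omega> < T (Suc m) \<omega>"
      by linarith
    then show "j \<le> m"
      by (simp add: strict_mono_less[OF mono])
  next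
    assume j: "j \<le> m"
    show "T j \<omega> \<le> t"
    proof (cases j)
      case 0
      then show ?thesis using T0 t by simp
    next
      case (Suc l)
      with j have "\<not> t < T (Suc l) \<omega>"
        unfolding m(1) by (intro not_less_Least) simp
      with Suc show ?thesis
        by simp
    qed
  qed
  have "{j. 1 \<le> j \<and> T j \<omega> \<le> t} = {1..m}"
    by (auto simp: le)
  then have N_eq: "N t \<omega> = m"
    by (simp add: count)
  then show "N t \<omega> = (LEAST n. t < T (Suc n) \<omega>)"
    by (simp only: m(1))
  show "T j \<omega> \<le> t \<longleftrightarrow> j \<le> N t \<omega>"
    unfolding N_eq by (rule le)
qed

text \<open>\<open>N t\<close> is a function of the clock, so a run of this random depth is a
  function of the three sequences, measurable by splitting over the countably many depths.
  Integrating out the marks first leaves \<open>mean\<close>.\<close>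

lemma (in weighted_thinning) nn_integral_run_driving_sequences:
  assumes M: "prob_space M" and N: "poisson_process M r N T"
    and U: "iid_uniform M U" and V: "iid_uniform M V" and ind: "indep_sequences M T U V"
    and t: "0 \<le> t"
    and Y: "\<And>\<omega>. \<omega> \<in> space M \<Longrightarrow>
      Y \<omega> = run (\<lambda>j. T j \<omega>) (N t \<omega>) 0 0 \<theta> \<nu> (\<lambda>n. U (Suc n) \<omega>) (\<lambda>n. V (Suc n) \<omega>)"
  shows "Y \<in> borel_measurable M"
    and "(\<integral>\<^sup>+\<omega>. Y \<omega> \<partial>M) = (\<integral>\<^sup>+\<omega>. mean (\<lambda>j. T j \<omega>) (N t \<omega>) 0 0 \<theta> \<nu> \<partial>M)"
proof -
  interpret prob_space M by (rule M)
  \<comment> \<open>\<open>case_nat 0 w\<close> restores \<open>T 0 = 0\<close>, since the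
    independence assumption concerns indices from 1 on.\<close>
  define F where "F w = run (case_nat 0 w) (LEAST n. t < w n) 0 0 \<theta> \<nu>" for w
  have F [measurable]: "(\<lambda>(w, u, v). F w u v) \<in> borel_measurable (borel_seq \<Otimes>\<^sub>M borel_seq \<Otimes>\<^sub>M borel_seq)"
  proof -
    have clock: "(\<lambda>x. case_nat 0 (fst x) n) \<in> borel_measurable (borel_seq \<Otimes>\<^sub>M borel_seq \<Otimes>\<^sub>M borel_seq)" for n
      by (cases n) simp_all
    have "(\<lambda>x. run (case_nat 0 (fst x)) (LEAST n. t < fst x n) 0 0 \<theta> \<nu> (fst (snd x)) (snd (snd x)))
        \<in> borel_measurable (borel_seq \<Otimes>\<^sub>M borel_seq \<Otimes>\<^sub>M borel_seq)"
    proof (rule measurable_compose_countable'[where I = UNIV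
          and f = "\<lambda>d x. run (case_nat 0 (fst x)) d 0 0 \<theta> \<nu> (fst (snd x)) (snd (snd x))"])
      show "(\<lambda>x. run (case_nat 0 (fst x)) d 0 0 \<theta> \<nu> (fst (snd x)) (snd (snd x)))
          \<in> borel_measurable (borel_seq \<Otimes>\<^sub>M borel_seq \<Otimes>\<^sub>M borel_seq)" for d
        by (rule measurable_run[OF clock]) measurable
    qed auto
    then show ?thesis
      by (simp add: F_def split_beta')
  qed
  have clock: "(\<lambda>j. T j \<omega>) = case_nat 0 (\<lambda>n. T (Suc n) \<omega>)" if "\<omega> \<in> space M" for \<omega>
    using poisson_processD(2)[OF N that] by (auto simp: fun_eq_iff split: nat.split)
  have run_F: "run (\<lambda>j. T j \<omega>) (N t \<omega>) 0 0 \<theta> \<nu> = F (\<lambda>n. T (Suc n) \<omega>)" if "\<omega> \<in> space M" for \<omega>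
    unfolding F_def poisson_process_count(1)[OF N that t, symmetric] clock[OF that] ..
  have rv: "random_variable borel (T j)" "random_variable borel (U (Suc n))" "random_variable borel (V (Suc n))" for j n
    using U V by (auto simp: iid_uniform_def indep_vars_def intro: poisson_processD(1)[OF N])
  have "(\<lambda>\<omega>. (\<lambda>n. T (Suc n) \<omega>, \<lambda>n. U (Suc n) \<omega>, \<lambda>n. V (Suc n) \<omega>)) \<in> M \<rightarrow>\<^sub>M borel_seq \<Otimes>\<^sub>M borel_seq \<Otimes>\<^sub>M borel_seq"
    by (intro measurable_Pair measurable_PiM_single') (auto simp: rv)
  from measurable_compose[OF this F]
  have "(\<lambda>\<omega>. F (\<lambda>n. T (Suc n) \<omega>) (\<lambda>n. U (Suc n) \<omega>) (\<lambda>n. V (Suc n) \<omega>)) \<in> borel_measurable M"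
    by simp
  then show "Y \<in> borel_measurable M"
    by (rule measurable_cong[THEN iffD2, rotated]) (simp add: Y run_F)
  have "(\<integral>\<^sup>+\<omega>. Y \<omega> \<partial>M) = (\<integral>\<^sup>+\<omega>. F (\<lambda>n. T (Suc n) \<omega>) (\<lambda>n. U (Suc n) \<omega>) (\<lambda>n. V (Suc n) \<omega>) \<partial>M)"
    by (intro nn_integral_cong) (simp add: Y run_F)
  also have "\<dots> = (\<integral>\<^sup>+\<omega>. \<integral>\<^sup>+u. \<integral>\<^sup>+v. F (\<lambda>n. T (Suc n) \<omega>) u v \<partial>unif_seq \<partial>unif_seq \<partial>M)"
    by (rule nn_integral_driving_sequences[OF U V ind F])
  also have "\<dots> = (\<integral>\<^sup>+\<omega>. mean (\<lambda>j. T j \<omega>) (N t \<omega>) 0 0 \<theta> \<nu> \<partial>M)"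
    by (intro nn_integral_cong) (simp add: mean_def run_F)
  finally show "(\<integral>\<^sup>+\<omega>. Y \<omega> \<partial>M) = (\<integral>\<^sup>+\<omega>. mean (\<lambda>j. T j \<omega>) (N t \<omega>) 0 0 \<theta> \<nu> \<partial>M)" .
qed

section \<open>The weight\<close>

text \<open>Both the power and the product gain exactly one factor; their ratio is the rejection
  weight \<open>b\<close> of the recursion.\<close>

lemma weight_Z_last_Suc:
  assumes "jump_index S n = enat i" "i \<le> j"
  shows "weight_Z_last \<Phi> lam Q lam' q' L T S (Suc j) n = weight_Z_last \<Phi> lam Q lam' q' L T S j n *
    ((1 - lam (jump_mode S n, \<Phi> (jump_mode S n) (T (Suc j) - T i) (jump_pos S n)) / L) /
     (1 - lam' (jump_mode S n) / L))"
  using assms by (simp add: weight_Z_last_def Let_def Suc_diff_le prod.cl_ivl_Suc divide_inverse)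

text \<open>At an acceptance the open last factor becomes a completed \<open>weight_Z\<close>, which
  adds \<open>lam / lam'\<close> after \<open>L\<close> cancels. The new last factor has empty
  products and contributes only its \<open>weight_kappa\<close>.\<close>

lemma weight_Z_last_jump:
  assumes "L \<noteq> 0" "jump_index S n = enat i" "i \<le> j" "jump_index S (Suc n) = enat (Suc j)"
    and "jump_pos S (Suc n) = \<Phi> (jump_mode S n) (T (Suc j) - T i) (jump_pos S n)"
  shows "weight_Z_last \<Phi> lam Q lam' q' L T S (Suc j) (Suc n) * weight_Z \<Phi> lam Q lam' q' L T S n =
    weight_Z_last \<Phi> lam Q lam' q' L T S j n *
      (mode_prob Q (jump_mode S n, jump_pos S (Suc n)) (jump_mode S (Suc n)) /
         q' (jump_mode S n) (jump_mode S (Suc n)) *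
       (lam (jump_mode S n, jump_pos S (Suc n)) / lam' (jump_mode S n)))"
proof -
  \<comment> \<open>The accepted candidate is not among the rejected ones, so the completed factor
    and the open one carry the same exponent.\<close>
  have "Suc j - i - 1 = j - i"
    using assms(3) by simp
  with assms show ?thesis
    by (simp add: weight_Z_last_def weight_Z_def weight_kappa_def[of _ _ _ "Suc n"] Let_def divide_inverse
        atLeastLessThanSuc_atLeastAtMost)
qed

lemma weight_nonneg:
  assumes "0 < L" "\<And>x. 0 \<le> lam x" "\<And>x. lam x \<le> L" "\<And>\<theta>. 0 \<le> lam' \<theta>" "\<And>\<theta>. lam' \<theta> \<le> L"
    and "\<And>\<theta> \<theta>'. 0 \<le> q' \<theta> \<theta>'"
  shows "0 \<le> weight_Z_last \<Phi> lam Q lam' q' L T S m n" "0 \<le> weight_Z \<Phi> lam Q lam' q' L T S n"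
proof -
  have "0 \<le> 1 - lam x / L" "0 \<le> 1 - lam' \<theta> / L" for x \<theta>
    using assms by auto
  with assms show "0 \<le> weight_Z_last \<Phi> lam Q lam' q' L T S m n" "0 \<le> weight_Z \<Phi> lam Q lam' q' L T S n"
    by (auto simp: weight_Z_last_def weight_Z_def weight_kappa_def mode_prob_def Let_def
        intro!: mult_nonneg_nonneg prod_nonneg divide_nonneg_nonneg)
qed

text \<open>\<open>\<Phi>\<close> is assumed measurable at nonnegative times only;
  \<open>max 0\<close> extends it measurably without changing it where the process evaluates it. The
  payoff branches on \<open>t = 0\<close> because the process starts at \<open>x0\<close> whatever
  \<open>\<Phi> \<theta> 0\<close> is.\<close>

lemma weighted_thinning_pdp:
  fixes lam :: "'k \<times> real \<Rightarrow> real" and g :: "'k \<times> real \<Rightarrow> real"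
  assumes I: "enumerates_modes k I" and pdp: "pdp_characteristics \<Phi> lam Q"
    and lam_max: "\<And>x. lam x \<le> L"
    and a: "\<And>\<theta> \<theta>'. (\<lambda>\<nu>. a \<theta> \<nu> \<theta>') \<in> borel_measurable borel"
    and b: "\<And>\<theta>. b \<theta> \<in> borel_measurable borel"
    and g: "g \<in> borel_measurable pdp_space"
  shows "weighted_thinning (\<lambda>\<theta> s. \<Phi> \<theta> (max 0 s)) lam L (next_mode k I Q) (mode_prob Q) a b
    (\<lambda>\<theta> s \<nu>. ennreal (g (if t = 0 then x0 else (\<theta>, \<Phi> \<theta> (max 0 (t - s)) \<nu>))))"
proof -
  interpret mode_kernel k I Q
    by unfold_locales (rule I pdp_characteristicsD(4)[OF pdp])+
  note \<Phi> = pdp_characteristicsD(1)[OF pdp]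
  note lam = pdp_characteristicsD(2,3)[OF pdp]
  have flow: "(\<lambda>z. \<Phi> \<theta> (max 0 (f z)) (snd z)) \<in> borel_measurable (borel \<Otimes>\<^sub>M borel)"
    if "f \<in> borel_measurable (borel \<Otimes>\<^sub>M borel)" for \<theta> and f :: "real \<times> real \<Rightarrow> real"
  proof -
    have "(\<lambda>z. (max 0 (f z), snd z)) \<in> borel \<Otimes>\<^sub>M borel \<rightarrow>\<^sub>M restrict_space (borel :: (real \<times> real) measure) ({0..} \<times> UNIV)"
      using that by (intro measurable_restrict_space2) (auto simp: borel_prod[symmetric])
    from measurable_compose[OF this \<Phi>[of \<theta>]] show ?thesis
      by simp
  qed
  show ?thesis
  proof
    show "countable (UNIV :: 'k set)"
      using I by (rule countable_modes_if_enumerates)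
    show "(\<lambda>(s, \<nu>). \<Phi> \<theta> (max 0 s) \<nu>) \<in> borel_measurable (borel \<Otimes>\<^sub>M borel)" for \<theta>
      using flow[of fst \<theta>] by (simp add: split_beta')
    show "(\<lambda>\<nu>. lam (\<theta>, \<nu>)) \<in> borel_measurable borel" for \<theta>
      by (rule measurable_compose[OF measurable_Pair_mode lam(1)])
    show "(\<lambda>(\<nu>, y). next_mode k I Q (\<theta>, \<nu>) y) \<in> borel \<Otimes>\<^sub>M borel \<rightarrow>\<^sub>M count_space UNIV" for \<theta>
      by (rule measurable_next_mode)
    show "(\<lambda>(s, \<nu>). ennreal (g (if t = 0 then x0 else (\<theta>, \<Phi> \<theta> (max 0 (t - s)) \<nu>))))
        \<in> borel_measurable (borel \<Otimes>\<^sub>M borel)" for \<theta>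
    proof (cases "t = 0")
      case False
      have [measurable]: "(\<lambda>z. \<Phi> \<theta> (max 0 (t - fst z)) (snd z)) \<in> borel_measurable (borel \<Otimes>\<^sub>M borel)"
        by (rule flow) measurable
      have "(\<lambda>z. (\<theta>, \<Phi> \<theta> (max 0 (t - fst z)) (snd z))) \<in> borel \<Otimes>\<^sub>M borel \<rightarrow>\<^sub>M pdp_space"
        by measurable
      from measurable_compose[OF this g] show ?thesis
        using False by (simp add: split_beta')
    qed simp
    show "0 \<le> lam x" "lam x \<le> L" "0 < L" for x
      using lam(2)[of x] lam_max[of x] by linarith+
    show "(\<integral>\<^sup>+y. f (next_mode k I Q x y) \<partial>unif) = (\<integral>\<^sup>+\<theta>. ennreal (mode_prob Q x \<theta>) * f \<theta> \<partial>count_space UNIV)" for x f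
      by (rule nn_integral_next_mode)
  qed (rule a b)+
qed

section \<open>Both processes as runs of the recursion, and the passage to signed
  \<open>g\<close>\<close>

theorem corollary2p1:
  fixes M :: "'a measure"
    and k :: "nat \<Rightarrow> 'k" and I :: "nat set"
    and \<Phi> :: "'k \<Rightarrow> real \<Rightarrow> real \<Rightarrow> real"
    and lam lamt :: "'k \<times> real \<Rightarrow> real"
    and Q Qt :: "'k \<times> real \<Rightarrow> ('k \<times> real) measure"
    and lamt' :: "'k \<Rightarrow> real" and qt' :: "'k \<Rightarrow> 'k \<Rightarrow> real"
    and lam_max horizon t :: real
    and N :: "real \<Rightarrow> 'a \<Rightarrow> nat" and T U V :: "nat \<Rightarrow> 'a \<Rightarrow> real"
    and x0 :: "'k \<times> real" and g :: "'k \<times> real \<Rightarrow> real"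
    and S St :: "'a \<Rightarrow> nat \<Rightarrow> enat \<times> 'k \<times> real"
    and X Xt :: "real \<Rightarrow> 'a \<Rightarrow> 'k \<times> real" and Rt :: "real \<Rightarrow> 'a \<Rightarrow> real"
  assumes "prob_space M"
    and "enumerates_modes k I"
    and "pdp_characteristics \<Phi> lam Q"
    and "pdp_characteristics \<Phi> lamt Qt"
    and "\<And>x. lam x \<le> lam_max"
    and "\<And>\<theta> \<nu>. lamt (\<theta>, \<nu>) = lamt' \<theta>"
    and "\<And>\<theta> \<nu> \<theta>'. mode_prob Qt (\<theta>, \<nu>) \<theta>' = qt' \<theta> \<theta>'"
    and "\<And>\<theta> \<theta>'. 0 < qt' \<theta> \<theta>'"
    and "\<And>\<theta>. 0 < lamt' \<theta> \<and> lamt' \<theta> < lam_max"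
    and "poisson_process M lam_max N T"
    and "iid_uniform M U"
    and "iid_uniform M V"
    and "indep_sequences M T U V"
    and "t \<in> {0..horizon}"
    and "g \<in> borel_measurable pdp_space"
    and "bounded (range g)"
  defines "S \<equiv> \<lambda>\<omega>. skeleton k I \<Phi> lam Q lam_max x0 (\<lambda>j. T j \<omega>) (\<lambda>j. U j \<omega>) (\<lambda>j. V j \<omega>)"
    and "St \<equiv> \<lambda>\<omega>. skeleton k I \<Phi> lamt Qt lam_max x0 (\<lambda>j. T j \<omega>) (\<lambda>j. U j \<omega>) (\<lambda>j. V j \<omega>)"
  defines "X \<equiv> \<lambda>s \<omega>. pdp_at (\<lambda>j. T j \<omega>) (S \<omega>) \<Phi> s"
    and "Xt \<equiv> \<lambda>s \<omega>. pdp_at (\<lambda>j. T j \<omega>) (St \<omega>) \<Phi> s"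
    and "Rt \<equiv> \<lambda>s \<omega>. weight_R \<Phi> lam Q lamt' qt' lam_max (\<lambda>j. T j \<omega>) (St \<omega>) (N s \<omega>) s"
  shows "integrable M (\<lambda>\<omega>. g (Xt t \<omega>) * Rt t \<omega>) \<and> integrable M (\<lambda>\<omega>. g (X t \<omega>)) \<and>
    prob_space.expectation M (\<lambda>\<omega>. g (Xt t \<omega>) * Rt t \<omega>) = prob_space.expectation M (\<lambda>\<omega>. g (X t \<omega>))"
proof -
  interpret prob_space M by fact
  have t: "0 \<le> t" using assms(14) by simp
  have lam_pos: "0 < lam x" for x
    by (rule pdp_characteristicsD(3)[OF assms(3)])
  have L: "0 < lam_max"
    using lam_pos[of x0] assms(5)[of x0] by linarith
  note nonneg = weight_nonneg[OF L less_imp_le[OF lam_pos] assms(5)]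
  have Z_nonneg: "0 \<le> weight_Z_last \<Phi> lam Q lamt' qt' lam_max \<tau> S m n"
    "0 \<le> weight_Z \<Phi> lam Q lamt' qt' lam_max \<tau> S n" for \<tau> S m n
    by (intro nonneg less_imp_le[OF assms(8)] less_imp_le[OF conjunct1[OF assms(9)]]
        less_imp_le[OF conjunct2[OF assms(9)]])+
  have Rt_nonneg: "0 \<le> Rt t \<omega>" for \<omega>
    by (auto simp: Rt_def weight_R_def Let_def intro!: mult_nonneg_nonneg prod_nonneg Z_nonneg)
  define a where "a \<theta> \<nu> \<theta>' = ennreal (mode_prob Q (\<theta>, \<nu>) \<theta>' / mode_prob Qt (\<theta>, \<nu>) \<theta>' * (lam (\<theta>, \<nu>) / lamt (\<theta>, \<nu>)))" for \<theta> \<nu> \<theta>'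
  define b where "b \<theta> \<nu> = ennreal ((1 - lam (\<theta>, \<nu>) / lam_max) / (1 - lamt (\<theta>, \<nu>) / lam_max))" for \<theta> \<nu>
  \<comment> \<open>\<open>ennreal\<close> cuts negative values off and the weight is nonnegative,
    so for real \<open>f\<close> this is the identity for its positive part. It is used below for
    \<open>g\<close>, \<open>- g\<close> and the absolute value of \<open>g\<close>.\<close>
  have key: "(\<lambda>\<omega>. ennreal (f (Xt t \<omega>) * Rt t \<omega>)) \<in> borel_measurable M \<and>
      (\<lambda>\<omega>. ennreal (f (X t \<omega>))) \<in> borel_measurable M \<and>
      (\<integral>\<^sup>+\<omega>. ennreal (f (Xt t \<omega>) * Rt t \<omega>) \<partial>M) = (\<integral>\<^sup>+\<omega>. ennreal (f (X t \<omega>)) \<partial>M)"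
    if f: "f \<in> borel_measurable pdp_space" for f :: "'k \<times> real \<Rightarrow> real"
  proof -
    define h where "h \<theta> s \<nu> = ennreal (f (if t = 0 then x0 else (\<theta>, \<Phi> \<theta> (max 0 (t - s)) \<nu>)))" for \<theta> s \<nu>
    interpret K: mode_kernel k I Q
      by unfold_locales (rule assms(2) pdp_characteristicsD(4)[OF assms(3)])+
    have [measurable]: "(\<lambda>\<nu>. lam (\<theta>, \<nu>)) \<in> borel_measurable borel" for \<theta>
      by (rule measurable_compose[OF measurable_Pair_mode pdp_characteristicsD(2)[OF assms(3)]])
    have [measurable]: "(\<lambda>\<nu>. mode_prob Q (\<theta>, \<nu>) \<theta>') \<in> borel_measurable borel" for \<theta> \<theta>'
      by (rule measurable_compose[OF measurable_Pair_mode K.measurable_mode_prob])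
    interpret P: weighted_thinning "\<lambda>\<theta> s. \<Phi> \<theta> (max 0 s)" lam lam_max "next_mode k I Q" "mode_prob Q"
      "\<lambda>_ _ _. 1" "\<lambda>_ _. 1" h
      unfolding h_def[abs_def] using assms(2,3,5) f by (intro weighted_thinning_pdp) auto
    have P': "weighted_thinning (\<lambda>\<theta> s. \<Phi> \<theta> (max 0 s)) lamt lam_max (next_mode k I Qt) (mode_prob Qt) a b h"
    proof -
      have "lamt x \<le> lam_max" for x
        using assms(6,9) by (cases x) (auto intro: less_imp_le)
      then show ?thesis
        unfolding h_def[abs_def]
      proof (intro weighted_thinning_pdp assms(2,4) f)
        show "(\<lambda>\<nu>. a \<theta> \<nu> \<theta>') \<in> borel_measurable borel" for \<theta> \<theta>'
          unfolding a_def assms(6,7) by measurable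
        show "b \<theta> \<in> borel_measurable borel" for \<theta>
          unfolding b_def[abs_def] assms(6) by measurable
      qed auto
    qed
    interpret P': weighted_thinning "\<lambda>\<theta> s. \<Phi> \<theta> (max 0 s)" lamt lam_max "next_mode k I Qt" "mode_prob Qt" a b h
      by (rule P')
    have T: "mono (\<lambda>j. T j \<omega>)" "T 0 \<omega> = 0" if "\<omega> \<in> space M" for \<omega>
      using poisson_processD(2,3)[OF assms(10) that] by (auto intro: strict_mono_mono)
    \<comment> \<open>All weights are 1 here, so the collected weight \<open>A\<close> is constant
      and the run returns the terminal payoff.\<close>
    have X_run: "ennreal (f (X t \<omega>)) =
        P.run (\<lambda>j. T j \<omega>) (N t \<omega>) 0 0 (fst x0) (snd x0) (\<lambda>n. U (Suc n) \<omega>) (\<lambda>n. V (Suc n) \<omega>)"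
      if \<omega>: "\<omega> \<in> space M" for \<omega>
    proof -
      note count = poisson_process_count(2)[OF assms(10) \<omega> t]
      have "0 < jump_index (S \<omega>) (Suc 0)"
        using jump_index_Suc_less[OF jump_index_0[unfolded zero_enat_def]]
        by (simp only: S_def zero_enat_def)
      then obtain n i where n: "jump_index (S \<omega>) n = enat i" "i \<le> N t \<omega>" "enat (N t \<omega>) < jump_index (S \<omega>) (Suc n)"
        and "P.run (\<lambda>j. T j \<omega>) (N t \<omega>) 0 0 (fst x0) (snd x0) (\<lambda>n. U (Suc n) \<omega>) (\<lambda>n. V (Suc n) \<omega>) =
          h (jump_mode (S \<omega>) n) (T i \<omega>) (jump_pos (S \<omega>) n)"
        using P.run_along_skeleton[where A = "\<lambda>_ _. 1" and n = 0 and i = 0 and j = 0 and d = "N t \<omega>"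
            and \<Psi> = \<Phi> and Q = Q and k = k and I = I and T = "\<lambda>j. T j \<omega>" and U = "\<lambda>j. U j \<omega>"
            and V = "\<lambda>j. V j \<omega>" and ?x0.0 = x0] T(1)[OF \<omega>]
        by (auto simp: S_def jump_index_0 jump_mode_def jump_pos_def zero_enat_def simp del: skeleton.simps(2))
      moreover have "X t \<omega> = (if t = 0 then x0 else (jump_mode (S \<omega>) n, \<Phi> (jump_mode (S \<omega>) n) (t - T i \<omega>) (jump_pos (S \<omega>) n)))"
        unfolding X_def S_def
        by (rule pdp_at_skeleton(2)[where m = "N t \<omega>"]) (use n count in \<open>auto simp: S_def\<close>)
      ultimately show ?thesis
        using count[of i] n by (simp add: h_def max_def)
    qed
    have Xt_run: "ennreal (f (Xt t \<omega>) * Rt t \<omega>) =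
        P'.run (\<lambda>j. T j \<omega>) (N t \<omega>) 0 0 (fst x0) (snd x0) (\<lambda>n. U (Suc n) \<omega>) (\<lambda>n. V (Suc n) \<omega>)"
      if \<omega>: "\<omega> \<in> space M" for \<omega>
    proof -
      note count = poisson_process_count(2)[OF assms(10) \<omega> t]
      define \<tau> where "\<tau> j = T j \<omega>" for j
      let ?Zl = "weight_Z_last \<Phi> lam Q lamt' qt' lam_max \<tau> (St \<omega>)"
      let ?Z = "weight_Z \<Phi> lam Q lamt' qt' lam_max \<tau> (St \<omega>)"
      \<comment> \<open>The value \<open>weight_R\<close> would have with \<open>j\<close>
        candidates and \<open>n\<close> jumps so far. Keeping the last factor open at
        \<open>j\<close> makes it meaningful in mid-run; at \<open>j = N t\<close> it is
        \<open>Rt t \<omega>\<close>.\<close>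
      define A where "A n j = ennreal (?Zl j n * (\<Prod>l<n. ?Z l))" for n j
      have St: "St \<omega> = skeleton k I \<Phi> lamt Qt lam_max x0 \<tau> (\<lambda>j. U j \<omega>) (\<lambda>j. V j \<omega>)"
        by (simp add: St_def \<tau>_def[abs_def])
      have "mono \<tau>"
        using T(1)[OF \<omega>] by (simp add: \<tau>_def[abs_def])
      have stay: "A n (Suc j) = A n j * b (jump_mode (St \<omega>) n)
          (\<Phi> (jump_mode (St \<omega>) n) (\<tau> (Suc j) - \<tau> i) (jump_pos (St \<omega>) n))"
        if "jump_index (St \<omega>) n = enat i" "i \<le> j" for n i j
      proof -
        have "0 \<le> ?Zl j n * (\<Prod>l<n. ?Z l)"
          by (intro mult_nonneg_nonneg prod_nonneg Z_nonneg ballI)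
        then show ?thesis
          unfolding A_def b_def assms(6) weight_Z_last_Suc[OF that]
          by (simp only: ennreal_mult'[symmetric] mult.assoc mult.commute mult.left_commute)
      qed
      have jump: "A (Suc n) (Suc j) = A n j * a (jump_mode (St \<omega>) n) (jump_pos (St \<omega>) (Suc n)) (jump_mode (St \<omega>) (Suc n))"
        if n: "jump_index (St \<omega>) n = enat i" "i \<le> j" "jump_index (St \<omega>) (Suc n) = enat (Suc j)" for n i j
      proof -
        have pos: "jump_pos (St \<omega>) (Suc n) = \<Phi> (jump_mode (St \<omega>) n) (\<tau> (Suc j) - \<tau> i) (jump_pos (St \<omega>) n)"
          unfolding St by (rule skeleton_Suc_enat(2)) (use n in \<open>simp_all only: St\<close>)
        have "?Zl (Suc j) (Suc n) * (\<Prod>l<Suc n. ?Z l) = (?Zl (Suc j) (Suc n) * ?Z n) * (\<Prod>l<n. ?Z l)"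
          by (simp add: mult_ac)
        moreover have "0 \<le> ?Zl j n * (\<Prod>l<n. ?Z l)"
          by (intro mult_nonneg_nonneg prod_nonneg Z_nonneg ballI)
        ultimately show ?thesis
          unfolding A_def a_def assms(6,7) weight_Z_last_jump[where \<Phi> = \<Phi> and T = \<tau>, OF less_imp_neq[OF L, symmetric] n pos]
          by (simp only: ennreal_mult'[symmetric] mult.assoc mult.commute mult.left_commute)
      qed
      have A_0: "A 0 0 = 1"
        by (simp add: A_def weight_Z_last_def weight_kappa_def Let_def St jump_index_0 zero_enat_def)
      have "0 < jump_index (St \<omega>) (Suc 0)"
        using jump_index_Suc_less[OF jump_index_0[unfolded zero_enat_def]]
        by (simp only: St zero_enat_def)
      then obtain n i where n: "jump_index (St \<omega>) n = enat i" "i \<le> N t \<omega>" "enat (N t \<omega>) < jump_index (St \<omega>) (Suc n)"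
        and "P'.run \<tau> (N t \<omega>) 0 0 (fst x0) (snd x0) (\<lambda>n. U (Suc n) \<omega>) (\<lambda>n. V (Suc n) \<omega>) =
          A n (N t \<omega>) * h (jump_mode (St \<omega>) n) (\<tau> i) (jump_pos (St \<omega>) n)"
        using P'.run_along_skeleton[where A = A and n = 0 and i = 0 and j = 0 and d = "N t \<omega>"
            and \<Psi> = \<Phi> and Q = Qt and k = k and I = I and T = \<tau> and U = "\<lambda>j. U j \<omega>"
            and V = "\<lambda>j. V j \<omega>" and ?x0.0 = x0] \<open>mono \<tau>\<close> stay jump A_0
        by (auto simp: St jump_index_0 jump_mode_def jump_pos_def zero_enat_def simp del: skeleton.simps(2))
      moreover have "Xt t \<omega> = (if t = 0 then x0 else (jump_mode (St \<omega>) n, \<Phi> (jump_mode (St \<omega>) n) (t - \<tau> i) (jump_pos (St \<omega>) n)))"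
        unfolding Xt_def \<tau>_def[abs_def, symmetric] St
        by (rule pdp_at_skeleton(2)[where m = "N t \<omega>"]) (use n count in \<open>auto simp: St \<tau>_def\<close>)
      moreover have "jump_count \<tau> (St \<omega>) t = n"
        unfolding St
        by (rule pdp_at_skeleton(1)[where m = "N t \<omega>"]) (use n count in \<open>auto simp: St \<tau>_def\<close>)
      moreover have "Rt t \<omega> = weight_R \<Phi> lam Q lamt' qt' lam_max \<tau> (St \<omega>) (N t \<omega>) t"
        by (simp add: Rt_def \<tau>_def[abs_def])
      ultimately have "P'.run \<tau> (N t \<omega>) 0 0 (fst x0) (snd x0) (\<lambda>n. U (Suc n) \<omega>) (\<lambda>n. V (Suc n) \<omega>) =
          ennreal (Rt t \<omega>) * ennreal (f (Xt t \<omega>))"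
        using count[of i] by (simp add: A_def h_def weight_R_def max_def \<tau>_def)
      then show ?thesis
        using Rt_nonneg[of \<omega>] by (simp add: \<tau>_def[abs_def] ennreal_mult'[symmetric] mult.commute)
    qed
    note X_int = P.nn_integral_run_driving_sequences[OF assms(1,10-13) t X_run]
    note Xt_int = P'.nn_integral_run_driving_sequences[OF assms(1,10-13) t Xt_run]
    \<comment> \<open>Both expectations are integrals of these means over the clock, so agreement
      for each fixed sequence \<open>w\<close> suffices.\<close>
    have "P'.mean w d j i \<theta> \<nu> = P.mean w d j i \<theta> \<nu>" for w d j i \<theta> \<nu>
      unfolding a_def[abs_def] b_def[abs_def]
    proof (rule mean_change_of_measure)
      show "weighted_thinning (\<lambda>\<theta> s. \<Phi> \<theta> (max 0 s)) lam lam_max (next_mode k I Q) (mode_prob Q)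
          (\<lambda>_ _ _. 1) (\<lambda>_ _. 1) h" ..
      show "0 < mode_prob Qt x \<theta>" "0 < lamt x" "lamt x < lam_max" for x \<theta>
        using assms(6-9) by (cases x; simp)+
    qed (use P' in \<open>simp_all add: a_def[abs_def] b_def[abs_def] K.mode_prob_nonneg\<close>)
    then show ?thesis
      using X_int Xt_int by simp
  qed
  \<comment> \<open>\<open>key\<close> gives measurability only after truncation by
    \<open>ennreal\<close>; a real function is recovered as the difference of its positive and
    negative parts.\<close>
  have real_measurable: "f \<in> borel_measurable M"
    if "(\<lambda>\<omega>. ennreal (f \<omega>)) \<in> borel_measurable M" "(\<lambda>\<omega>. ennreal (- f \<omega>)) \<in> borel_measurable M" for f
  proof -
    note [measurable] = that
    have "(\<lambda>\<omega>. enn2real (ennreal (f \<omega>)) - enn2real (ennreal (- f \<omega>))) \<in> borel_measurable M"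
      by measurable
    also have "(\<lambda>\<omega>. enn2real (ennreal (f \<omega>)) - enn2real (ennreal (- f \<omega>))) = f"
    proof
      show "enn2real (ennreal (f \<omega>)) - enn2real (ennreal (- f \<omega>)) = f \<omega>" for \<omega>
        by (cases "0 \<le> f \<omega>") (auto simp: ennreal_neg)
    qed
    finally show ?thesis .
  qed
  obtain B where B: "\<And>x. \<bar>g x\<bar> \<le> B"
    using assms(16) by (auto simp: bounded_iff)
  note g_pos = key[OF assms(15)]
  have g_neg: "(\<lambda>\<omega>. ennreal (- (g (Xt t \<omega>) * Rt t \<omega>))) \<in> borel_measurable M \<and>
      (\<lambda>\<omega>. ennreal (- g (X t \<omega>))) \<in> borel_measurable M \<and>
      (\<integral>\<^sup>+\<omega>. ennreal (- (g (Xt t \<omega>) * Rt t \<omega>)) \<partial>M) = (\<integral>\<^sup>+\<omega>. ennreal (- g (X t \<omega>)) \<partial>M)"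
    using key[of "\<lambda>x. - g x"] assms(15) by simp
  have meas: "(\<lambda>\<omega>. g (Xt t \<omega>) * Rt t \<omega>) \<in> borel_measurable M" "(\<lambda>\<omega>. g (X t \<omega>)) \<in> borel_measurable M"
    using g_pos g_neg by (auto intro!: real_measurable)
  have "(\<integral>\<^sup>+\<omega>. ennreal \<bar>g (X t \<omega>)\<bar> \<partial>M) \<le> (\<integral>\<^sup>+\<omega>. ennreal B \<partial>M)"
    by (intro nn_integral_mono ennreal_leI B)
  also have "\<dots> < \<infinity>"
    by (simp add: emeasure_space_1)
  finally have fin: "(\<integral>\<^sup>+\<omega>. ennreal \<bar>g (X t \<omega>)\<bar> \<partial>M) < \<infinity>" .
  \<comment> \<open>Boundedness of \<open>g\<close> controls the unweighted side; the identity for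
    the absolute value carries finiteness over to the weighted one.\<close>
  have "(\<integral>\<^sup>+\<omega>. ennreal \<bar>g (Xt t \<omega>) * Rt t \<omega>\<bar> \<partial>M) = (\<integral>\<^sup>+\<omega>. ennreal \<bar>g (X t \<omega>)\<bar> \<partial>M)"
    using key[of "\<lambda>x. \<bar>g x\<bar>"] assms(15) Rt_nonneg by (simp add: abs_mult)
  with fin meas have int: "integrable M (\<lambda>\<omega>. g (Xt t \<omega>) * Rt t \<omega>)" "integrable M (\<lambda>\<omega>. g (X t \<omega>))"
    by (auto simp: integrable_iff_bounded)
  then have "expectation (\<lambda>\<omega>. g (Xt t \<omega>) * Rt t \<omega>) = expectation (\<lambda>\<omega>. g (X t \<omega>))"
    using g_pos g_neg by (simp add: real_lebesgue_integral_def)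
  with int show ?thesis
    by simp
qed

end
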